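(* Let $N$ be a finite group of order $n$ with $n$ not divisible by $4$. Then the pair $(C_n,N)$ is realizable if and only if $N$ is a $C$-group.
   Context: $C_n$ denotes the cyclic group of order $n$. A finite group is called a $C$-group if all of its Sylow subgroups are cyclic. For a finite group $N$, the holomorph is $\mathrm{Hol}(N)=\rho(N)\rtimes\mathrm{Aut}(N)$, the subgroup of the group of permutations of $N$ generated by $\mathrm{Aut}(N)$ and the maps $\rho(\eta)=(x\mapsto x\eta^{-1})$, $\eta\in N$. A subgroup $\mathcal{G}$ of $\mathrm{Hol}(N)$ is regular if the map $\mathcal{G}\to N$, $\sigma\mapsto\sigma(1_N)$, is a bijection. For finite groups $G,N$ of the same order, the pair $(G,N)$ is called realizable if $\mathrm{Hol}(N)$ contains a regular subgroup isomorphic to $G$ (equivalently, there is a skew brace with additive group $N$ and multiplicative group $G$). *)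

theory Defs
  imports "HOL-Algebra.Sylow" "HOL-Algebra.Bij" "HOL-Algebra.Elementary_Groups"
begin

definition sylow_subgroup :: "nat \<Rightarrow> 'a set \<Rightarrow> ('a, 'b) monoid_scheme \<Rightarrow> bool" where
  "sylow_subgroup p P G \<longleftrightarrow>
     prime p \<and> subgroup P G \<and> card P = p ^ multiplicity p (order G)"

text \<open>For primes \<open>p\<close> not dividing the order, the Sylow subgroup is trivial and hence cyclic, so
  quantifying over all primes is harmless.\<close>

definition C_group :: "('a, 'b) monoid_scheme \<Rightarrow> bool" where
  "C_group G \<longleftrightarrow> group G \<and> finite (carrier G) \<and>
     (\<forall>p P. sylow_subgroup p P G \<longrightarrow> cyclic_group (G\<lparr>carrier := P\<rparr>))"

text \<open>Permutations of the carrier are the extensional bijections in \<open>Bij (carrier N)\<close>; hence the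
  restricted lambda.\<close>

definition hol_rho :: "('a, 'b) monoid_scheme \<Rightarrow> 'a \<Rightarrow> ('a \<Rightarrow> 'a)" where
  "hol_rho N \<eta> = (\<lambda>x \<in> carrier N. x \<otimes>\<^bsub>N\<^esub> inv\<^bsub>N\<^esub> \<eta>)"

definition holomorph :: "('a, 'b) monoid_scheme \<Rightarrow> ('a \<Rightarrow> 'a) monoid" where
  "holomorph N = subgroup_generated (BijGroup (carrier N)) (hol_rho N ` carrier N \<union> auto N)"

definition regular_on :: "('a \<Rightarrow> 'a) set \<Rightarrow> ('a, 'b) monoid_scheme \<Rightarrow> bool" where
  "regular_on H N \<longleftrightarrow> bij_betw (\<lambda>\<sigma>. \<sigma> \<one>\<^bsub>N\<^esub>) H (carrier N)"

definition realizable :: "('g, 'c) monoid_scheme \<Rightarrow> ('a, 'b) monoid_scheme \<Rightarrow> bool" where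
  "realizable G N \<longleftrightarrow>
     (\<exists>H. subgroup H (holomorph N) \<and> regular_on H N \<and> G \<cong> (holomorph N)\<lparr>carrier := H\<rparr>)"

text \<open>\<open>subgroup_generated\<close> intersects its generating set with the carrier of the ambient group; the
  next two lemmas show that nothing is lost here.\<close>

lemma (in group) hol_rho_in_Bij:
  assumes "\<eta> \<in> carrier G"
  shows "hol_rho G \<eta> \<in> carrier (BijGroup (carrier G))"
proof -
  have "bij_betw (hol_rho G \<eta>) (carrier G) (carrier G)"
    unfolding hol_rho_def
    by (rule bij_betw_byWitness[where f' = "\<lambda>x. x \<otimes> \<eta>"])
      (use assms in \<open>auto simp: m_assoc\<close>)
  then show ?thesis
    by (simp add: BijGroup_def Bij_def) (simp add: hol_rho_def)
qed

lemma (in group) holomorph_carrier: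
  "carrier (holomorph G) = generate (BijGroup (carrier G)) (hol_rho G ` carrier G \<union> auto G)"
proof -
  have "hol_rho G ` carrier G \<union> auto G \<subseteq> carrier (BijGroup (carrier G))"
    using hol_rho_in_Bij subgroup.subset[OF subgroup_auto] by auto
  then show ?thesis
    by (simp add: holomorph_def carrier_subgroup_generated Int_absorb1)
qed

lemma group_holomorph: "group (holomorph N)"
  unfolding holomorph_def by (rule group.group_subgroup_generated[OF group_BijGroup])

end

theory Submission
  imports Defs "HOL-Algebra.Group_Action" "HOL-Algebra.Multiplicative_Group" "HOL-Algebra.Weak_Morphisms"
    "HOL-Number_Theory.Residues"
begin

text \<open>
  A generator of a cyclic regular subgroup of the holomorph is an affine map
  \<open>\<sigma> x = \<phi> x \<cdot> a\<close> that permutes \<open>N\<close> in a single cycle. For a prime \<open>p\<close>, the power \<open>\<tau>\<close> of \<open>\<sigma>\<close> of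
  order the \<open>p\<close>-part of \<open>n\<close> has a linear part of \<open>p\<close>-power order, which therefore fixes a Sylow
  subgroup \<open>Q\<close>; then \<open>\<tau>\<close> fixes a coset \<open>Q x\<close>, and after a translation \<open>Q\<close> itself carries a
  transitive affine map. For odd \<open>p\<close> this forces \<open>Q\<close> to be cyclic: divide out a central subgroup of
  order \<open>p\<close> fixed by the linear part, and compute in coordinates modulo \<open>p\<close>. For \<open>p = 2\<close> the Sylow
  subgroups have order at most two.

  Conversely, the transfer for the smallest prime divisor shows that a nontrivial \<open>C\<close>-group is not
  perfect. Hence its commutator subgroup is cyclic, and \<open>N = \<langle>x\<rangle>\<langle>y\<rangle>\<close> with \<open>x\<close> and \<open>y\<close> of coprime
  orders; the map \<open>z \<mapsto> x z y\<close> then generates a regular cyclic subgroup of the holomorph.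
\<close>

section \<open>Actions of \<open>p\<close>-groups and Sylow subgroups\<close>

text \<open>The condition on 4 cannot be dropped: a 4-cycle generates a regular subgroup in the
  holomorph of the Klein four group, which is the symmetric group of degree 4. In the coordinate
  computation the culprit is n (n - 1) / 2, which has period \<open>p\<close> modulo
  \<open>p\<close> only for odd \<open>p\<close>. The orbit of the identity under a Sylow subgroup
  of the regular group need not be a subgroup of N. Fixed points replace it: the number of Sylow
  subgroups and their index are both prime to \<open>p\<close>, so maps of \<open>p\<close>-power
  order must fix one of each. In the converse, write D for the commutator subgroup. Every subgroup
  of a \<open>C\<close>-group has cyclic abelianization, and automorphisms of a cyclic group
  commute, so D centralizes D'/D''. As D/D' is cyclic, D/D'' is abelian, D' is perfect, hence
  trivial, and D is cyclic. Take x generating D and y generating N modulo D, with y acting on D by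
  the exponent r. The commutator of y and x is a power of x with exponent r - 1 and generates D, so
  r - 1 is a unit modulo \<open>ord x\<close> and the powers of y meet D trivially. A prime dividing
  both orders would give two subgroups of order \<open>p\<close> in one cyclic Sylow
  subgroup.\<close>

lemma p_group_action_fixed_points:
  fixes R (structure)
  assumes "group R" "order R = p ^ k" "prime p" "finite S"
    and closed: "\<And>g s. g \<in> carrier R \<Longrightarrow> s \<in> S \<Longrightarrow> a g s \<in> S"
    and one: "\<And>s. s \<in> S \<Longrightarrow> a \<one> s = s"
    and mult: "\<And>g h s. g \<in> carrier R \<Longrightarrow> h \<in> carrier R \<Longrightarrow> s \<in> S \<Longrightarrow> a (g \<otimes> h) s = a g (a h s)"
  shows "[card S = card {s \<in> S. \<forall>g \<in> carrier R. a g s = s}] (mod p)"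
proof -
  interpret group R by fact
  define \<phi> where "\<phi> = (\<lambda>g. \<lambda>s\<in>S. a g s)"
  define F where "F = {s \<in> S. \<forall>g \<in> carrier R. a g s = s}"
  have inv_l: "a (inv g) (a g s) = s" "a g (a (inv g) s) = s" if "g \<in> carrier R" "s \<in> S" for g s
    using mult[of "inv g" g s] mult[of g "inv g" s] that one by simp_all
  have bij: "\<phi> g \<in> Bij S" if g: "g \<in> carrier R" for g
  proof -
    have "bij_betw (a g) S S"
      by (rule bij_betw_byWitness[where f' = "a (inv g)"]) (use g inv_l closed in auto)
    then show ?thesis
      unfolding Bij_def \<phi>_def by (simp cong: bij_betw_cong)
  qed
  have "\<phi> \<in> hom R (BijGroup S)"
  proof (rule homI)
    fix g h assume "g \<in> carrier R" "h \<in> carrier R"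
    then show "\<phi> (g \<otimes> h) = \<phi> g \<otimes>\<^bsub>BijGroup S\<^esub> \<phi> h"
      using bij by (auto simp: BijGroup_def compose_def \<phi>_def mult closed fun_eq_iff)
  qed (use bij in \<open>simp add: BijGroup_def\<close>)
  then interpret group_action R S \<phi>
    by (simp add: group_action_def group_hom_def group_hom_axioms_def group_BijGroup)
  have orb: "orbit R \<phi> s = {a g s | g. g \<in> carrier R}" if "s \<in> S" for s
    using that by (auto simp: orbit_def \<phi>_def)
  \<comment> \<open>Orbit by orbit, the size agrees modulo \<open>p\<close> with the number of fixed
    points: a one-point orbit counts 1 on both sides; any other orbit has size a nontrivial power of
    \<open>p\<close> and contains no fixed point.\<close>
  have "[(\<Sum>s\<in>O'. 1) = (\<Sum>s\<in>O'. if s \<in> F then 1 else 0)] (mod p)" if O': "O' \<in> orbits R S \<phi>" for O'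
  proof -
    obtain s where s: "s \<in> S" "O' = orbit R \<phi> s"
      using O' by (auto simp: orbits_def)
    have fin: "finite O'" "O' \<subseteq> S"
      using s orb closed \<open>finite S\<close> by (auto intro: finite_subset[of _ S])
    show ?thesis
    proof (cases "s \<in> F")
      case True
      then have "O' = {s}"
        using s orb[OF s(1)] by (auto simp: F_def intro!: exI[of _ \<one>])
      then show ?thesis using True by simp
    next
      case False
      have "card O' dvd p ^ k"
        using orbit_stabilizer_theorem[OF s(1)] s assms(2) by (metis dvd_triv_left)
      moreover have "card O' \<noteq> 1"
      proof
        assume "card O' = 1"
        then obtain t where t: "O' = {t}" by (auto simp: card_1_singleton_iff)
        have "a g s = t" if "g \<in> carrier R" for g using t s orb that by blast
        then have "a g s = s" if "g \<in> carrier R" for g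
          using that one[OF s(1)] one_closed by metis
        then show False using False s(1) by (simp add: F_def)
      qed
      ultimately obtain i where "card O' = p ^ i" "i \<noteq> 0"
        using divides_primepow_nat[OF \<open>prime p\<close>] by (metis power_0)
      then have "p dvd card O'" by simp
      moreover have "t \<notin> F" if t: "t \<in> O'" for t
      proof
        assume "t \<in> F"
        obtain g where g: "g \<in> carrier R" "t = a g s" using t s orb by blast
        have "s = a (inv g) t" using g s inv_l by simp
        also have "\<dots> = t" using \<open>t \<in> F\<close> g by (simp add: F_def)
        finally show False using \<open>t \<in> F\<close> False by simp
      qed
      ultimately show ?thesis by (simp add: cong_0_iff)
    qed
  qed
  then have "[(\<Sum>O'\<in>orbits R S \<phi>. \<Sum>s\<in>O'. 1) = (\<Sum>O'\<in>orbits R S \<phi>. \<Sum>s\<in>O'. if s \<in> F then 1 else 0)] (mod p)"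
    by (rule cong_sum)
  moreover have "(\<Sum>s\<in>S. if s \<in> F then 1 else 0) = card F"
    using \<open>finite S\<close> by (simp add: sum.If_cases F_def Int_def)
  ultimately show ?thesis
    unfolding disjoint_sum[OF \<open>finite S\<close>] F_def by simp
qed

text \<open>The iterates of \<open>f\<close> are an action of the integers modulo
  \<open>p ^ k\<close>, whose common fixed points are those of \<open>f\<close>.\<close>

lemma p_power_permutation_fixed_points:
  fixes f :: "'a \<Rightarrow> 'a"
  assumes "prime p" "finite S" and closed: "\<And>s. s \<in> S \<Longrightarrow> f s \<in> S"
    and period: "\<And>s. s \<in> S \<Longrightarrow> (f ^^ (p ^ k)) s = s"
  shows "[card S = card {s \<in> S. f s = s}] (mod p)"
proof -
  define n where "n = p ^ k"
  have n: "n > 0" using \<open>prime p\<close> by (simp add: n_def prime_gt_0_nat)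
  define R where "R = integer_mod_group n"
  have carR: "carrier R = {0..<int n}" using n by (simp add: R_def carrier_integer_mod_group)
  have it: "(f ^^ i) s \<in> S" if "s \<in> S" for i s using that closed by (induction i) auto
  have per: "(f ^^ (n * i)) s = s" if "s \<in> S" for i s
  proof (induction i)
    case (Suc i)
    have "(f ^^ (n * Suc i)) s = (f ^^ n) ((f ^^ (n * i)) s)" by (simp add: funpow_add)
    then show ?case using Suc period[OF that] by (simp add: n_def)
  qed simp
  have red: "(f ^^ (i mod n)) s = (f ^^ i) s" if "s \<in> S" for i s
  proof -
    have "(f ^^ i) s = (f ^^ (i mod n + n * (i div n))) s" by simp
    also have "\<dots> = (f ^^ (i mod n)) ((f ^^ (n * (i div n))) s)" by (simp only: funpow_add o_apply)
    finally show ?thesis using per that by simp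
  qed
  have "[card S = card {s \<in> S. \<forall>g \<in> carrier R. (f ^^ nat g) s = s}] (mod p)"
  proof (rule p_group_action_fixed_points[where k = k])
    show "order R = p ^ k" by (simp add: order_def carR) (simp add: n_def)
    fix g h s assume gh: "g \<in> carrier R" "h \<in> carrier R" "s \<in> S"
    have "nat (g \<otimes>\<^bsub>R\<^esub> h) = (nat g + nat h) mod n"
      using gh n by (simp add: R_def carrier_integer_mod_group nat_mod_distrib nat_add_distrib)
    then show "(f ^^ nat (g \<otimes>\<^bsub>R\<^esub> h)) s = (f ^^ nat g) ((f ^^ nat h) s)"
      using red[OF gh(3)] by (simp add: funpow_add)
  qed (use assms it in \<open>auto simp: R_def\<close>)
  moreover have "(\<forall>g \<in> carrier R. (f ^^ nat g) s = s) \<longleftrightarrow> f s = s" if s: "s \<in> S" for s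
  proof
    assume *: "\<forall>g \<in> carrier R. (f ^^ nat g) s = s"
    show "f s = s"
    \<comment> \<open>For \<open>n = 1\<close> the residue 1 is missing from the carrier, but then
      \<open>period\<close> itself says \<open>f s = s\<close>.\<close>
    proof (cases "n = 1")
      case True
      then show ?thesis using period[OF s, folded n_def] True by simp
    next
      case False
      then show ?thesis using * n carR by (auto dest: bspec[of _ _ 1])
    qed
  next
    assume "f s = s"
    then have "(f ^^ i) s = s" for i by (induction i) auto
    then show "\<forall>g \<in> carrier R. (f ^^ nat g) s = s" by simp
  qed
  ultimately show ?thesis by (simp cong: conj_cong)
qed

context group
begin

text \<open>\<open>R\<close> acts on the right cosets of \<open>Q\<close> by
  \<open>C #> inv g\<close>. There are \<open>m\<close> of them, prime to \<open>p\<close>, so some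
  \<open>Q #> x\<close> is fixed by all of \<open>R\<close>, which says that conjugation by
  \<open>x\<close> carries \<open>R\<close> into \<open>Q\<close>.\<close>

lemma p_subgroup_conjugate_in_sylow:
  assumes "finite (carrier G)" "prime p" "order G = p ^ a * m" "\<not> p dvd m"
    and Q: "subgroup Q G" "card Q = p ^ a" and R: "subgroup R G" "card R = p ^ k"
  shows "\<exists>x \<in> carrier G. \<forall>r \<in> R. x \<otimes> r \<otimes> inv x \<in> Q"
proof -
  interpret Q: subgroup Q G by fact
  interpret R: subgroup R G by fact
  have Qc: "Q \<subseteq> carrier G" by (rule Q.subset)
  define F where "F = {C \<in> rcosets Q. \<forall>g \<in> R. C #> inv g = C}"
  have "card (rcosets Q) * p ^ a = p ^ a * m"
    using lagrange[OF Q(1)] Q(2) assms(3) by simp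
  then have m: "card (rcosets Q) = m"
    using \<open>prime p\<close> by (simp add: prime_gt_0_nat)
  have "[card (rcosets Q) = card {C \<in> rcosets Q. \<forall>g \<in> carrier (G\<lparr>carrier := R\<rparr>). C #> inv g = C}] (mod p)"
  proof (rule p_group_action_fixed_points[where k = k])
    show "Group.group (G\<lparr>carrier := R\<rparr>)" by (rule subgroup_imp_group) fact
    show "order (G\<lparr>carrier := R\<rparr>) = p ^ k" using R by (simp add: order_def)
    show "finite (rcosets Q)"
      using assms(1) rcosets_subset_PowG[OF Q(1)] by (simp add: finite_subset)
    fix g C assume gC: "g \<in> carrier (G\<lparr>carrier := R\<rparr>)" "C \<in> rcosets Q"
    then obtain x where x: "x \<in> carrier G" "C = Q #> x" by (auto simp: RCOSETS_def)
    show "C #> inv g \<in> rcosets Q"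
      using gC x Qc by (simp add: coset_mult_assoc rcosetsI)
    fix h assume "h \<in> carrier (G\<lparr>carrier := R\<rparr>)"
    then show "C #> inv (g \<otimes>\<^bsub>G\<lparr>carrier := R\<rparr>\<^esub> h) = (C #> inv h) #> inv g"
      using gC x Qc by (simp add: coset_mult_assoc inv_mult_group m_assoc)
  qed (use assms in \<open>auto simp: RCOSETS_def coset_mult_assoc Qc\<close>)
  then have "\<not> p dvd card F"
    using m assms(4) by (simp add: F_def cong_dvd_iff)
  then have "F \<noteq> {}" by auto
  then obtain x where x: "x \<in> carrier G" and fixed: "\<And>g. g \<in> R \<Longrightarrow> (Q #> x) #> inv g = Q #> x"
    by (auto simp: F_def RCOSETS_def)
  have "x \<otimes> r \<otimes> inv x \<in> Q" if r: "r \<in> R" for r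
  proof -
    have "Q #> (x \<otimes> r) = Q #> x"
      using fixed[of "inv r"] r x by (simp add: coset_mult_assoc Qc)
    then have "x \<otimes> r \<in> Q #> x"
      using rcos_self[of "x \<otimes> r" Q] r x Q(1) by simp
    then show ?thesis using x by (simp add: Q.rcos_module_imp is_group)
  qed
  with x show ?thesis by blast
qed

lemma conjugate_subgroup:
  assumes "x \<in> carrier G" "subgroup H G"
  shows "subgroup (x <# H #> inv x) G" "card (x <# H #> inv x) = card H"
    "x <# H #> inv x = (\<lambda>h. x \<otimes> h \<otimes> inv x) ` H"
proof -
  have sub: "H \<subseteq> carrier G" using assms(2) by (rule subgroup.subset)
  show eq: "x <# H #> inv x = (\<lambda>h. x \<otimes> h \<otimes> inv x) ` H"
    by (auto simp: l_coset_def r_coset_def)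
  have "inj_on (\<lambda>h. x \<otimes> h \<otimes> inv x) H"
    by (rule inj_onI) (use assms(1) sub in \<open>auto simp: subset_iff\<close>)
  then show "card (x <# H #> inv x) = card H"
    unfolding eq by (rule card_image)
  show "subgroup (x <# H #> inv x) G"
    using subgroup_conjugation_is_surj1[of "inv x" H] assms by simp
qed

lemma sylow_subgroups_conjugate:
  assumes "finite (carrier G)" "prime p" "order G = p ^ a * m" "\<not> p dvd m"
    and Q: "subgroup Q G" "card Q = p ^ a" and R: "subgroup R G" "card R = p ^ a"
  shows "\<exists>x \<in> carrier G. R = x <# Q #> inv x"
proof -
  obtain x where x: "x \<in> carrier G" "\<And>q. q \<in> Q \<Longrightarrow> x \<otimes> q \<otimes> inv x \<in> R"
    using p_subgroup_conjugate_in_sylow[OF assms(1-4) R Q] by blast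
  have "finite R" using R(1) assms(1) finite_subset subgroup.subset by blast
  then have "x <# Q #> inv x = R"
    using conjugate_subgroup[OF x(1) Q(1)] x(2) Q(2) R(2) by (intro card_subset_eq) auto
  then show ?thesis using x(1) by auto
qed

text \<open>The stabilizer of \<open>Q\<close> under conjugation contains \<open>Q\<close>, so the
  number of conjugates divides the index \<open>m\<close>.\<close>

lemma card_sylow_conjugates:
  assumes "finite (carrier G)" "prime p" "order G = p ^ a * m" "\<not> p dvd m"
    and Q: "subgroup Q G" "card Q = p ^ a"
  shows "\<not> p dvd card {x <# Q #> inv x | x. x \<in> carrier G}"
proof -
  interpret A: group_action G "{H. subgroup H G}" "\<lambda>g. \<lambda>H \<in> {H. subgroup H G}. g <# H #> (inv g)"
    by (rule action_by_conjugation_on_subgroups_set)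
  let ?a = "\<lambda>g. \<lambda>H \<in> {H. subgroup H G}. g <# H #> (inv g)"
  define S where "S = stabilizer G ?a Q"
  have S: "subgroup S G" using A.stabilizer_subgroup Q(1) by (simp add: S_def)
  have "q <# Q #> inv q = Q" if "q \<in> Q" for q
    using that Q(1) by (simp add: coset_join2 coset_join3 subgroup.mem_carrier subgroup.m_inv_closed)
  then have "Q \<subseteq> S"
    using Q(1) by (auto simp: S_def stabilizer_def subgroup.mem_carrier)
  then have "subgroup Q (G\<lparr>carrier := S\<rparr>)"
    using Q(1) S subgroup_incl by blast
  then have "card (rcosets\<^bsub>G\<lparr>carrier := S\<rparr>\<^esub> Q) * card Q = card S"
    using group.lagrange[OF subgroup_imp_group[OF S], of Q] by (simp add: order_def)
  then have "card Q dvd card S" by (metis dvd_triv_right)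
  then obtain c where "card S = p ^ a * c" using Q(2) by (auto elim: dvdE)
  moreover have "orbit G ?a Q = {x <# Q #> inv x | x. x \<in> carrier G}"
    using Q(1) by (auto simp: orbit_def)
  ultimately have "card {x <# Q #> inv x | x. x \<in> carrier G} * (p ^ a * c) = p ^ a * m"
    using A.orbit_stabilizer_theorem[of Q, folded S_def] Q(1) assms(3) by simp
  then have "card {x <# Q #> inv x | x. x \<in> carrier G} * c = m"
    using \<open>prime p\<close> by (simp add: prime_gt_0_nat mult.left_commute)
  then show ?thesis using assms(4) by auto
qed

text \<open>The map permutes the Sylow subgroups with \<open>p\<close>-power period, and their
  number is prime to \<open>p\<close>.\<close>

lemma sylow_fixed_by_p_automorphism:
  assumes "finite (carrier G)" "prime p" "order G = p ^ a * m" "\<not> p dvd m"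
    and \<psi>: "\<psi> \<in> hom G G" "\<And>x. x \<in> carrier G \<Longrightarrow> (\<psi> ^^ (p ^ k)) x = x"
  shows "\<exists>Q. subgroup Q G \<and> card Q = p ^ a \<and> \<psi> ` Q = Q"
proof -
  obtain Q where Q: "subgroup Q G" "card Q = p ^ a"
    using sylow_thm[OF assms(2) is_group assms(3,1)] by blast
  define S where "S = {x <# Q #> inv x | x. x \<in> carrier G}"
  have S: "subgroup P G" "card P = p ^ a" if "P \<in> S" for P
    using that conjugate_subgroup Q by (auto simp: S_def)
  interpret \<psi>: group_hom G G \<psi>
    using \<psi>(1) by (simp add: group_hom_def group_hom_axioms_def is_group)
  have inj: "inj_on \<psi> (carrier G)"
  proof (rule inj_onI)
    fix x y assume xy: "x \<in> carrier G" "y \<in> carrier G" "\<psi> x = \<psi> y"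
    obtain j where j: "p ^ k = Suc j"
      using \<open>prime p\<close> by (metis gr0_implies_Suc prime_gt_0_nat zero_less_power)
    show "x = y"
      using \<psi>(2)[OF xy(1)] \<psi>(2)[OF xy(2)] xy(3) by (simp add: j funpow_Suc_right del: funpow.simps)
  qed
  have "[card S = card {P \<in> S. \<psi> ` P = P}] (mod p)"
  proof (rule p_power_permutation_fixed_points[where k = k])
    show "finite S" unfolding S_def using assms(1) by simp
    fix P assume P: "P \<in> S"
    have Pc: "P \<subseteq> carrier G" using S[OF P] subgroup.subset by blast
    have "subgroup (\<psi> ` P) G"
      by (rule \<psi>.subgroup_img_is_subgroup) (use S[OF P] in simp)
    moreover have "card (\<psi> ` P) = p ^ a"
      using S[OF P] Pc inj by (metis card_image inj_on_subset)
    ultimately show "\<psi> ` P \<in> S"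
      using sylow_subgroups_conjugate[OF assms(1-4) Q] unfolding S_def by blast
    have "((`) \<psi> ^^ i) P = (\<psi> ^^ i) ` P" for i by (induction i) (auto simp: image_image)
    then show "((`) \<psi> ^^ (p ^ k)) P = P"
      using \<psi>(2) Pc by (auto simp: subset_iff image_iff)
  qed fact
  then have "\<not> p dvd card {P \<in> S. \<psi> ` P = P}"
    using card_sylow_conjugates[OF assms(1-4) Q] by (simp add: cong_dvd_iff S_def)
  then have "{P \<in> S. \<psi> ` P = P} \<noteq> {}" by (metis card.empty dvd_0_right)
  then show ?thesis using S by blast
qed

end

section \<open>\<open>p\<close>-groups with a transitive affine map\<close>

lemma fermat_theorem_int:
  fixes x :: int
  assumes "prime p" "\<not> int p dvd x"
  shows "[x ^ (p - 1) = 1] (mod int p)"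
proof -
  define y where "y = nat (x mod int p)"
  have p: "0 < int p" using \<open>prime p\<close> by (simp add: prime_gt_0_nat)
  have y: "[x = int y] (mod int p)" using p by (simp add: y_def)
  then have "\<not> p dvd y" using assms(2) by (metis cong_dvd_iff int_dvd_int_iff cong_sym)
  then have "[int y ^ (p - 1) = 1] (mod int p)"
    using fermat_theorem[OF \<open>prime p\<close>, of y] by (metis cong_int_iff of_nat_1 of_nat_power)
  then show ?thesis using y by (meson cong_pow cong_trans)
qed

text \<open>Raising to the \<open>p\<close>-th power is the identity modulo \<open>p\<close>, so the
  left side is just \<open>r\<close>. Used to see that a linear part of \<open>p\<close>-power order
  acts trivially modulo \<open>p\<close>.\<close>

lemma cong_one_of_prime_power_power:
  fixes r :: int
  assumes "prime p" "[r ^ (p ^ k) = 1] (mod int p)"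
  shows "[r = 1] (mod int p)"
proof -
  have pow: "[x ^ p = x] (mod int p)" for x :: int
  proof (cases "int p dvd x")
    case True
    then have "int p dvd x ^ p" using \<open>prime p\<close> by (simp add: dvd_power_le prime_gt_0_nat dvd_trans[OF _ dvd_power])
    then show ?thesis using True by (metis cong_0_iff cong_sym cong_trans)
  next
    case False
    then have "[x * x ^ (p - 1) = x * 1] (mod int p)"
      by (intro cong_mult cong_refl fermat_theorem_int assms(1))
    then show ?thesis
      using \<open>prime p\<close> by (metis mult.right_neutral power_eq_if prime_gt_0_nat less_irrefl)
  qed
  have "[r ^ (p ^ k) = r] (mod int p)"
  proof (induction k)
    case (Suc k)
    have "[(r ^ (p ^ k)) ^ p = r ^ (p ^ k)] (mod int p)" by (rule pow)
    then show ?case using Suc by (metis cong_trans power_Suc2 power_mult)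
  qed simp
  then show ?thesis using assms(2) by (metis cong_sym cong_trans)
qed

text \<open>The order of \<open>u\<close> divides both \<open>n\<close> and \<open>p - 1\<close>.
  With \<open>n\<close> the group order, this is where the choice of the smallest prime divisor
  enters.\<close>

lemma cong_one_of_coprime_power:
  fixes u :: int
  assumes "prime p" "coprime n (p - 1)" "n > 0" "[u ^ n = 1] (mod int p)"
  shows "[u = 1] (mod int p)"
proof -
  have "\<not> int p dvd u"
  proof
    assume "int p dvd u"
    then have "int p dvd u ^ n" using assms(3) by (simp add: dvd_power_le dvd_trans[OF _ dvd_power])
    then have "int p dvd 1" using assms(4) cong_dvd_iff by blast
    then show False using assms(1) by simp
  qed
  obtain x y where xy: "n * x = (p - 1) * y + 1"
    using bezout_nat[of n "p - 1"] assms(2,3) by auto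
  have "[(u ^ n) ^ x = 1 ^ x] (mod int p)" using assms(4) by (rule cong_pow)
  moreover have "(u ^ n) ^ x = (u ^ (p - 1)) ^ y * u"
    by (simp add: xy flip: power_mult)
  moreover have "[(u ^ (p - 1)) ^ y * u = 1 ^ y * u] (mod int p)"
    by (intro cong_mult cong_pow fermat_theorem_int) (use assms(1) \<open>\<not> int p dvd u\<close> in auto)
  ultimately show ?thesis by (simp add: cong_def)
qed

lemma ex_other_member_if_dvd_card:
  fixes p :: nat
  assumes "p dvd card S" "p > 1" "x \<in> S"
  shows "\<exists>y \<in> S. y \<noteq> x"
proof (rule ccontr)
  assume "\<not> (\<exists>y \<in> S. y \<noteq> x)"
  then have "S = {x}" using \<open>x \<in> S\<close> by blast
  then show False using assms by simp
qed

context group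
begin

text \<open>Two fixed-point counts: conjugation on the group makes the centre \<open>Z\<close>
  nontrivial, then \<psi> acts on \<open>S\<close>, the central elements killed by \<open>p\<close>.
  The size of \<open>S\<close> is a positive power of \<open>p\<close>, so \<open>p\<close> divides
  the number of points of \<open>S\<close> fixed by \<psi>, and \<open>\<one>\<close> is not the
  only one.\<close>

lemma p_group_fixed_central_element:
  assumes "prime p" "order G = p ^ a" "a > 0"
    and \<psi>: "\<psi> \<in> hom G G" "\<And>x. x \<in> carrier G \<Longrightarrow> (\<psi> ^^ (p ^ k)) x = x"
  shows "\<exists>z \<in> carrier G. z \<noteq> \<one> \<and> z [^] p = \<one> \<and> \<psi> z = z \<and> (\<forall>x \<in> carrier G. x \<otimes> z = z \<otimes> x)"
proof -
  interpret \<psi>: group_hom G G \<psi>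
    using \<psi>(1) by (simp add: group_hom_def group_hom_axioms_def is_group)
  have p: "p > 1" using \<open>prime p\<close> by (rule prime_gt_1_nat)
  have fin: "finite (carrier G)"
    using assms(2) p by (simp flip: order_gt_0_iff_finite)
  define Z where "Z = {z \<in> carrier G. \<forall>x \<in> carrier G. x \<otimes> z = z \<otimes> x}"
  have Zc: "z \<in> carrier G" if "z \<in> Z" for z using that by (simp add: Z_def)
  have Zcomm: "x \<otimes> z = z \<otimes> x" if "z \<in> Z" "x \<in> carrier G" for x z
    using that unfolding Z_def by blast
  have ZI: "z \<in> Z" if "z \<in> carrier G" "\<And>x. x \<in> carrier G \<Longrightarrow> x \<otimes> z = z \<otimes> x" for z
    using that unfolding Z_def by blast
  have "x \<otimes> z \<otimes> inv x = z \<longleftrightarrow> x \<otimes> z = z \<otimes> x" if "x \<in> carrier G" "z \<in> carrier G" for x z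
    using that by (metis inv_solve_right m_closed)
  then have Z: "Z = {z \<in> carrier G. \<forall>x \<in> carrier G. x \<otimes> z \<otimes> inv x = z}"
    by (auto simp: Z_def)
  have "[card (carrier G) = card Z] (mod p)"
    unfolding Z
    by (rule p_group_action_fixed_points[OF is_group assms(2)])
      (use assms fin in \<open>auto simp: m_assoc inv_mult_group\<close>)
  moreover have "p dvd card (carrier G)"
    using assms(2,3) by (simp add: order_def)
  ultimately have "p dvd card Z" by (simp add: cong_dvd_iff)
  moreover have "\<one> \<in> Z" by (rule ZI) auto
  ultimately obtain z0 where z0: "z0 \<in> Z" "z0 \<noteq> \<one>"
    using ex_other_member_if_dvd_card[of p Z \<one>] p by auto
  have z0c: "z0 \<in> carrier G" using z0 Zc by blast
  have "ord z0 dvd p ^ a" using ord_dvd_group_order[OF z0c] assms(2) by simp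
  then obtain i where i: "ord z0 = p ^ i"
    using divides_primepow_nat[OF \<open>prime p\<close>] by blast
  have "i \<noteq> 0" using i z0(2) z0c ord_eq_1 by (metis power_0)
  then obtain i' where i': "i = Suc i'" by (cases i) auto
  have Zpow: "z [^] n \<in> Z" if "z \<in> Z" for z and n :: nat
  proof -
    have "x \<otimes> z [^] n = z [^] n \<otimes> x" if "x \<in> carrier G" for x
      using group_commutes_pow[of z x n] Zcomm[OF \<open>z \<in> Z\<close> that] Zc[OF \<open>z \<in> Z\<close>] that by simp
    then show ?thesis using Zc[OF \<open>z \<in> Z\<close>] by (intro ZI) auto
  qed
  define z1 where "z1 = z0 [^] (p ^ i')"
  have "z1 \<noteq> \<one>"
    unfolding z1_def using z0c p i i' by (simp add: pow_eq_id dvd_imp_le)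
  have "z1 [^] p = \<one>"
    unfolding z1_def using z0c i i' by (simp add: nat_pow_pow pow_eq_id mult.commute)
  define S where "S = {z \<in> Z. z [^] p = \<one>}"
  have SZ: "z \<in> Z" if "z \<in> S" for z using that by (simp add: S_def)
  have S: "subgroup S G"
  proof
    fix x y assume xy: "x \<in> S" "y \<in> S"
    have c: "x \<in> carrier G" "y \<in> carrier G" "x \<otimes> y = y \<otimes> x"
      using Zc Zcomm SZ xy by blast+
    have "w \<otimes> (x \<otimes> y) = x \<otimes> y \<otimes> w" if w: "w \<in> carrier G" for w
    proof -
      have wx: "w \<otimes> x = x \<otimes> w" and wy: "w \<otimes> y = y \<otimes> w" using xy w SZ Zcomm by blast+
      have "w \<otimes> (x \<otimes> y) = w \<otimes> x \<otimes> y" using w c(1,2) by (simp add: m_assoc)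
      also have "\<dots> = x \<otimes> (w \<otimes> y)" unfolding wx using w c(1,2) by (simp add: m_assoc)
      also have "\<dots> = x \<otimes> y \<otimes> w" unfolding wy using w c(1,2) by (simp add: m_assoc)
      finally show ?thesis .
    qed
    moreover have "(x \<otimes> y) [^] p = \<one>"
      using xy pow_mult_distrib[OF c(3,1,2), of p] by (simp add: S_def)
    ultimately show "x \<otimes> y \<in> S" using c(1,2) by (simp add: S_def ZI)
  next
    fix x assume x: "x \<in> S"
    have xc: "x \<in> carrier G" using x SZ Zc by blast
    have "w \<otimes> inv x = inv x \<otimes> w" if w: "w \<in> carrier G" for w
    proof -
      have "w \<otimes> x = x \<otimes> w" using x w SZ Zcomm by blast
      then show ?thesis using w xc by (metis inv_closed inv_solve_left inv_solve_right m_assoc m_closed)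
    qed
    then show "inv x \<in> S" using x xc by (simp add: S_def ZI nat_pow_inv)
  qed (use Zc in \<open>auto simp: S_def intro!: ZI\<close>)
  have "finite S" using fin Zc SZ by (meson finite_subset subsetI)
  have "card S dvd p ^ a" using lagrange[OF S] assms(2) by (metis dvd_triv_right)
  then obtain j where j: "card S = p ^ j" using divides_primepow_nat[OF \<open>prime p\<close>] by blast
  have "z1 \<in> S" using \<open>z1 [^] p = \<one>\<close> Zpow[OF z0(1)] by (simp add: S_def z1_def)
  moreover have "\<one> \<in> S" using S by (rule subgroup.one_closed)
  ultimately have "card S \<noteq> 1"
    using \<open>z1 \<noteq> \<one>\<close> by (auto simp: card_1_singleton_iff)
  then have "p dvd card S" using j by (cases j) auto
  have "[card S = card {z \<in> S. \<psi> z = z}] (mod p)"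
  proof (rule p_power_permutation_fixed_points[where k = k])
    fix z assume z: "z \<in> S"
    have zc: "z \<in> carrier G" using z SZ Zc by blast
    have "x \<otimes> \<psi> z = \<psi> z \<otimes> x" if x: "x \<in> carrier G" for x
    proof -
      \<comment> \<open>The image of a central element commutes at first only with values of \<psi>.
        Every \<open>x\<close> is such a value, namely of its iterate number
        \<open>p ^ k - 1\<close>.\<close>
      obtain q where q: "p ^ k = Suc q"
        using p by (metis gr0_implies_Suc less_trans zero_less_one zero_less_power)
      define y where "y = (\<psi> ^^ q) x"
      have "(\<psi> ^^ n) x \<in> carrier G" for n using x by (induction n) auto
      then have y: "y \<in> carrier G" "\<psi> y = x" using \<psi>(2)[OF x] q by (simp_all add: y_def)
      have "y \<otimes> z = z \<otimes> y" using z y SZ Zcomm by blast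
      then have "\<psi> (y \<otimes> z) = \<psi> (z \<otimes> y)" by simp
      then show ?thesis using y zc by simp
    qed
    moreover have "\<psi> z [^] p = \<one>"
      using z zc \<psi>.hom_nat_pow[OF zc, of p] by (simp add: S_def)
    ultimately show "\<psi> z \<in> S" using zc by (simp add: S_def ZI)
    show "(\<psi> ^^ (p ^ k)) z = z" using \<psi>(2) zc by simp
  qed fact+
  then have "p dvd card {z \<in> S. \<psi> z = z}" using \<open>p dvd card S\<close> by (simp add: cong_dvd_iff)
  moreover have "\<one> \<in> {z \<in> S. \<psi> z = z}" using \<open>\<one> \<in> S\<close> by simp
  ultimately obtain z where z: "z \<in> S" "\<psi> z = z" "z \<noteq> \<one>"
    using ex_other_member_if_dvd_card[of p "{z \<in> S. \<psi> z = z}" \<one>] p by blast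
  have "z [^] p = \<one>" using z by (simp add: S_def)
  then show ?thesis using z(2,3) Zc[OF SZ[OF z(1)]] Zcomm[OF SZ[OF z(1)]] by blast
qed

lemma conj_hom: "x \<in> carrier G \<Longrightarrow> group_hom G G (\<lambda>y. x \<otimes> y \<otimes> inv x)"
  by (unfold_locales) (auto intro!: homI simp: m_assoc inv_solve_left)

lemma conj_int_pow:
  "x \<in> carrier G \<Longrightarrow> y \<in> carrier G \<Longrightarrow> x \<otimes> y [^] (i :: int) \<otimes> inv x = (x \<otimes> y \<otimes> inv x) [^] i"
  using group_hom.hom_int_pow[OF conj_hom] by simp

text \<open>In coordinates \<open>x = g\<^sup>i z\<^sup>j\<close>, the \<open>n\<close>-th iterate sends \<open>\<one>\<close> to a point with \<open>i \<equiv> n u\<close>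
  and \<open>j \<equiv> n v + s u n (n - 1) / 2\<close> modulo \<open>p\<close>; as \<open>p\<close> is odd, this has period \<open>p\<close> in \<open>n\<close>,
  too short to reach all \<open>p\<^sup>2\<close> residues.\<close>

lemma cyclic_p_group_of_central_extension:
  assumes ord: "order G = p ^ a" and p: "prime p" "odd p"
    and z: "z \<in> carrier G" "z [^] p = \<one>"
      "\<And>x. x \<in> carrier G \<Longrightarrow> x \<otimes> z = z \<otimes> x"
    and \<psi>: "\<psi> \<in> hom G G" "\<And>x. x \<in> carrier G \<Longrightarrow> (\<psi> ^^ (p ^ k)) x = x" "\<psi> z = z"
    and g: "g \<in> carrier G" and span: "\<And>x. x \<in> carrier G \<Longrightarrow> \<exists>(i :: int) (j :: int). x = g [^] i \<otimes> z [^] j"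
    and b: "b \<in> carrier G"
    and trans: "\<And>x. x \<in> carrier G \<Longrightarrow> \<exists>n. ((\<lambda>x. \<psi> x \<otimes> b) ^^ n) \<one> = x"
  shows "cyclic_group G"
proof (rule ccontr)
  assume not_cyc: "\<not> cyclic_group G"
  interpret \<psi>: group_hom G G \<psi>
    using \<psi>(1) by (simp add: group_hom_def group_hom_axioms_def is_group)
  have not_gen: "\<exists>x \<in> carrier G. \<forall>i :: int. x \<noteq> h [^] i" if "h \<in> carrier G" for h
    using not_cyc that int_pow_closed[OF that] unfolding cyclic_group by blast
  \<comment> \<open>Otherwise \<open>g\<close> alone would generate the group, against
    \<open>not_cyc\<close>. This makes the two coordinates independent.\<close>
  have z_not: "z \<noteq> g [^] i" for i :: int
  proof
    assume i: "z = g [^] i"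
    obtain x where x: "x \<in> carrier G" "\<And>j :: int. x \<noteq> g [^] j"
      using not_gen[OF g] by blast
    obtain j l :: int where "x = g [^] j \<otimes> z [^] l" using span[OF x(1)] by blast
    also have "\<dots> = g [^] (j + i * l)" using g by (simp add: i int_pow_pow int_pow_mult)
    finally show False using x(2) by blast
  qed
  have comm: "z [^] i \<otimes> x = x \<otimes> z [^] i" if x: "x \<in> carrier G" for i :: int and x
  proof -
    have "x \<otimes> z \<otimes> inv x = z" using z x by (simp add: m_assoc)
    then have "x \<otimes> z [^] i \<otimes> inv x = z [^] i"
      using conj_int_pow[of x z i] x z(1) by simp
    then show ?thesis using x z(1) inv_solve_right[of "z [^] i" "x \<otimes> z [^] i" x] by simp
  qed
  have mult: "(g [^] i \<otimes> z [^] j) \<otimes> (g [^] i' \<otimes> z [^] j') = g [^] (i + i') \<otimes> z [^] (j + j')"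
    for i j i' j' :: int
  proof -
    have "(g [^] i \<otimes> z [^] j) \<otimes> (g [^] i' \<otimes> z [^] j') = g [^] i \<otimes> (z [^] j \<otimes> g [^] i') \<otimes> z [^] j'"
      using g z(1) by (simp add: m_assoc)
    also have "\<dots> = g [^] (i + i') \<otimes> z [^] (j + j')"
      unfolding comm[OF int_pow_closed[OF g]] using g z(1) by (simp add: m_assoc int_pow_mult)
    finally show ?thesis .
  qed
  have zp: "z [^] i = \<one>" if "int p dvd i" for i :: int
    using z that by (auto simp: int_pow_int simp flip: int_pow_pow elim!: dvdE)
  have g1: "g \<noteq> \<one>"
  proof
    assume "g = \<one>"
    then show False using not_gen[OF z(1)] span z(1) by (metis int_pow_one l_one int_pow_closed)
  qed
  have "ord g dvd p ^ a" using ord_dvd_group_order[OF g] ord by simp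
  then have pg: "p dvd ord g"
    using divides_primepow_nat[OF p(1)] g1 ord_eq_1[OF g] by (metis dvd_power gr0I power_0)
  \<comment> \<open>An equality of two coordinate pairs gives a power of \<open>g\<close> equal to a
    power of \<open>z\<close>. If the latter exponent were a unit modulo \<open>p\<close>, then
    \<open>z\<close> would be a power of \<open>g\<close>; so it is divisible by \<open>p\<close>,
    and then \<open>ord g\<close>, a multiple of \<open>p\<close>, divides the other
    difference.\<close>
  have indep: "[i = i'] (mod int p) \<and> [j = j'] (mod int p)"
    if eq: "g [^] i \<otimes> z [^] j = g [^] i' \<otimes> z [^] j'" for i j i' j' :: int
  proof -
    have "g [^] (i - i') \<otimes> z [^] (j - j') = (g [^] (- i') \<otimes> z [^] (- j')) \<otimes> (g [^] i \<otimes> z [^] j)"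
      unfolding mult by simp
    also have "\<dots> = \<one>"
      unfolding eq mult by simp
    finally have "g [^] (i - i') = inv (z [^] (j - j'))"
      using g z(1) by (metis int_pow_closed inv_equality inv_inv)
    then have gz: "g [^] (i - i') = z [^] (j' - j)"
      using z(1) by (simp flip: int_pow_neg)
    have pj: "int p dvd j' - j"
    proof (rule ccontr)
      assume "\<not> int p dvd j' - j"
      then have "coprime (j' - j) (int p)"
        using p(1) by (metis coprime_commute prime_imp_coprime prime_nat_int_transfer)
      then obtain c where c: "[(j' - j) * c = 1] (mod int p)"
        using cong_solve_coprime_int by blast
      have "z [^] ((j' - j) * c) = z [^] ((j' - j) * c - 1) \<otimes> z"
        using z(1) by (metis diff_add_cancel int_pow_1 int_pow_mult)
      also have "\<dots> = z" using zp c z(1) by (simp add: cong_iff_dvd_diff)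
      finally have "z = g [^] ((i - i') * c)"
        using gz g z(1) by (metis int_pow_pow)
      then show False using z_not by blast
    qed
    then have "int (ord g) dvd i - i'"
      using gz zp[OF pj] int_pow_eq_id[OF g] by simp
    then have "int p dvd i - i'" using pg by (meson dvd_trans of_nat_dvd_iff)
    then show ?thesis using pj by (simp add: cong_iff_dvd_diff dvd_diff_commute)
  qed
  obtain r s :: int where rs: "\<psi> g = g [^] r \<otimes> z [^] s"
    using span[of "\<psi> g"] g by auto
  obtain u v :: int where uv: "b = g [^] u \<otimes> z [^] v"
    using span[OF b] by auto
  have \<psi>gz: "\<psi> (g [^] i \<otimes> z [^] j) = g [^] (r * i) \<otimes> z [^] (s * i + j)" for i j :: int
  proof -
    have "\<psi> (g [^] i \<otimes> z [^] j) = (g [^] r \<otimes> z [^] s) [^] i \<otimes> z [^] j"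
      using g z(1) \<psi>(3) rs by (simp add: \<psi>.hom_int_pow)
    also have "(g [^] r \<otimes> z [^] s) [^] i = g [^] (r * i) \<otimes> z [^] (s * i)"
      using g z(1) comm[of "g [^] r" s] by (simp add: int_pow_mult_distrib int_pow_pow)
    finally show ?thesis using g z(1) by (simp add: m_assoc int_pow_mult)
  qed
  \<comment> \<open>Only the first coordinate is tracked: it shows that the \<open>p ^ k\<close>-th
    power of \<open>r\<close> is 1 modulo \<open>p\<close>, so \<open>r\<close> itself is 1 modulo
    \<open>p\<close>.\<close>
  have "\<exists>c :: int. (\<psi> ^^ n) g = g [^] (r ^ n) \<otimes> z [^] c" for n
  proof (induction n)
    case 0
    then show ?case using g by (auto intro!: exI[of _ 0])
  next
    case (Suc n)
    then obtain c :: int where "(\<psi> ^^ n) g = g [^] (r ^ n) \<otimes> z [^] c" by auto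
    then show ?case using \<psi>gz[of "r ^ n" c] by auto
  qed
  then obtain c where "(\<psi> ^^ (p ^ k)) g = g [^] (r ^ (p ^ k)) \<otimes> z [^] (c :: int)" by blast
  then have "g [^] (r ^ (p ^ k)) \<otimes> z [^] c = g [^] (1 :: int) \<otimes> z [^] (0 :: int)"
    using \<psi>(2)[OF g] g by simp
  from indep[OF this] have r: "[r = 1] (mod int p)"
    using cong_one_of_prime_power_power[OF p(1)] by blast
  \<comment> \<open>The second coordinate is recorded doubled, so that the quadratic term needs no
    division by 2.\<close>
  have orbit: "\<exists>(i :: int) (j :: int). ((\<lambda>x. \<psi> x \<otimes> b) ^^ n) \<one> = g [^] i \<otimes> z [^] j \<and> [i = int n * u] (mod int p)
      \<and> [2 * j = 2 * int n * v + s * u * (int n * (int n - 1))] (mod int p)" for n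
  proof (induction n)
    case 0
    then show ?case by (intro exI[of _ 0]) simp
  next
    case (Suc n)
    then obtain i j :: int where ij: "((\<lambda>x. \<psi> x \<otimes> b) ^^ n) \<one> = g [^] i \<otimes> z [^] j"
        "[i = int n * u] (mod int p)"
        "[2 * j = 2 * int n * v + s * u * (int n * (int n - 1))] (mod int p)"
      by blast
    have "\<psi> (g [^] i \<otimes> z [^] j) \<otimes> b = g [^] (r * i + u) \<otimes> z [^] (s * i + j + v)"
      unfolding \<psi>gz uv mult ..
    then have "((\<lambda>x. \<psi> x \<otimes> b) ^^ Suc n) \<one> = g [^] (r * i + u) \<otimes> z [^] (s * i + j + v)"
      by (simp add: ij(1))
    moreover have "[r * i + u = 1 * (int n * u) + u] (mod int p)"
      using ij(2) r by (intro cong_add cong_mult) auto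
    moreover have "[2 * s * i + 2 * j + 2 * v
        = 2 * s * (int n * u) + (2 * int n * v + s * u * (int n * (int n - 1))) + 2 * v] (mod int p)"
      using ij(2,3) by (intro cong_add cong_mult) auto
    ultimately show ?case
      by (intro exI[of _ "r * i + u"] exI[of _ "s * i + j + v"]) (simp add: algebra_simps)
  qed
  \<comment> \<open>Two targets give the contradiction. Reaching \<open>g\<close> makes
    \<open>u\<close> a unit modulo \<open>p\<close>. Reaching \<open>z\<close> needs
    \<open>i\<close> congruent to 0, so \<open>p\<close> divides \<open>n\<close> and hence
    \<open>2 * j\<close>, although \<open>j\<close> is congruent to 1; thus \<open>p\<close> would
    divide 2.\<close>
  obtain n where n: "((\<lambda>x. \<psi> x \<otimes> b) ^^ n) \<one> = z" using trans[OF z(1)] by blast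
  obtain m where m: "((\<lambda>x. \<psi> x \<otimes> b) ^^ m) \<one> = g" using trans[OF g] by blast
  have "[1 = int m * u] (mod int p)"
  proof -
    obtain i j :: int where "g = g [^] i \<otimes> z [^] j" "[i = int m * u] (mod int p)"
      using orbit[of m] m by auto
    then show ?thesis
      using indep[of 1 0 i j] g cong_trans by (metis int_pow_0 int_pow_1 r_one)
  qed
  then have "\<not> int p dvd u"
    using p(1) by (metis cong_dvd_iff dvd_mult not_prime_unit prime_nat_int_transfer)
  obtain i j :: int where j: "z = g [^] i \<otimes> z [^] j" "[i = int n * u] (mod int p)"
      "[2 * j = 2 * int n * v + s * u * (int n * (int n - 1))] (mod int p)"
    using orbit[of n] n by auto
  then have ij: "[0 = i] (mod int p)" "[1 = j] (mod int p)"
    using indep[of 0 1 i j] z(1) by auto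
  then have "int p dvd int n * u"
    using j(2) by (metis cong_0_iff cong_sym cong_trans)
  then have "int p dvd int n"
    using p(1) \<open>\<not> int p dvd u\<close> prime_dvd_mult_iff[of "int p"] by auto
  then have "int p dvd 2 * int n * v + s * u * (int n * (int n - 1))" by simp
  then have "int p dvd 2 * j" using j(3) cong_dvd_iff by blast
  then have "int p dvd 2 * 1" using ij(2) by (metis cong_dvd_iff cong_refl cong_mult)
  then have "p dvd 2" by presburger
  then show False using p by (metis primes_dvd_imp_eq two_is_prime_nat even_numeral)
qed

end

text \<open>The induction step is stated with its hypothesis \<open>IH\<close> explicit and for
  monoids over the same element type. The quotient by the central subgroup must therefore live on
  elements of \<open>'a\<close>, not on cosets, which are sets.\<close>

lemma (in group) cyclic_p_group_of_transitive_affine_step: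
  assumes IH: "\<And>(K :: 'a monoid) \<psi> b. \<lbrakk>group K; order K = p ^ a; \<psi> \<in> hom K K;
      \<And>x. x \<in> carrier K \<Longrightarrow> (\<psi> ^^ (p ^ k)) x = x; b \<in> carrier K;
      \<And>x. x \<in> carrier K \<Longrightarrow> \<exists>n. ((\<lambda>x. \<psi> x \<otimes>\<^bsub>K\<^esub> b) ^^ n) \<one>\<^bsub>K\<^esub> = x\<rbrakk> \<Longrightarrow> cyclic_group K"
    and ord: "order G = p ^ Suc a" and p: "prime p" "odd p"
    and \<psi>: "\<psi> \<in> hom G G" "\<And>x. x \<in> carrier G \<Longrightarrow> (\<psi> ^^ (p ^ k)) x = x"
    and b: "b \<in> carrier G"
    and trans: "\<And>x. x \<in> carrier G \<Longrightarrow> \<exists>n. ((\<lambda>x. \<psi> x \<otimes> b) ^^ n) \<one> = x"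
  shows "cyclic_group G"
proof -
  interpret \<psi>: group_hom G G \<psi>
    using \<psi>(1) by (simp add: group_hom_def group_hom_axioms_def is_group)
  obtain z where z: "z \<in> carrier G" "z \<noteq> \<one>" "z [^] p = \<one>" "\<psi> z = z"
      "\<And>x. x \<in> carrier G \<Longrightarrow> x \<otimes> z = z \<otimes> x"
    using p_group_fixed_central_element[OF p(1) ord _ \<psi>] by blast
  define Z where "Z = range (\<lambda>i :: int. z [^] i)"
  have Z: "subgroup Z G" unfolding Z_def using subgroup_of_powers[OF z(1)] .
  have conj: "x \<otimes> c \<otimes> inv x = c" if x: "x \<in> carrier G" and c: "c \<in> Z" for x c
  proof -
    obtain i :: int where i: "c = z [^] i" using c by (auto simp: Z_def)
    have "x \<otimes> z \<otimes> inv x = z" using x z(1) z(5)[OF x] by (simp add: m_assoc)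
    then show ?thesis unfolding i using conj_int_pow[OF x z(1), of i] by simp
  qed
  have "Z \<lhd> G" using Z conj by (simp add: normal_inv_iff)
  then interpret Z: normal Z G .
  have "ord z = p"
  proof -
    have "ord z dvd p" using z(1,3) pow_eq_id by blast
    moreover have "ord z \<noteq> 1" using z(1,2) ord_eq_1 by blast
    ultimately show ?thesis using p(1) by (auto simp: prime_nat_iff)
  qed
  then have "card Z = p"
    using generate_pow_card[OF z(1)] generate_pow[OF z(1)] by (simp add: Z_def full_SetCompr_eq)
  \<comment> \<open>A choice of coset representatives; \<open>image_group f G\<close> is the factor
    group transported to them.\<close>
  define f where "f x = (SOME y. y \<in> Z #> x)" for x
  have f: "f x \<in> Z #> x" if "x \<in> carrier G" for x
    unfolding f_def using rcos_self[OF that Z] by (rule someI)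
  have f_eq: "f x = f y \<longleftrightarrow> x \<otimes> inv y \<in> Z" if "x \<in> carrier G" "y \<in> carrier G" for x y
  proof
    assume "f x = f y"
    then have "Z #> x = Z #> y"
      using f[OF that(1)] f[OF that(2)] repr_independence Z that by metis
    then show "x \<otimes> inv y \<in> Z"
      using rcos_self[OF that(1) Z] Z.rcos_module_imp[OF is_group that(2)] by simp
  next
    assume "x \<otimes> inv y \<in> Z"
    then have "Z #> y = Z #> x"
      using Z.rcos_module_rev[OF is_group that(2,1)] repr_independence that Z by metis
    then show "f x = f y" by (simp add: f_def)
  qed
  have w: "weak_group_morphism f Z G"
    by (rule weak_group_morphismsI[OF \<open>Z \<lhd> G\<close> f_eq])
  define K where "K = image_group f G"
  have carK: "carrier K = f ` carrier G" by (simp add: K_def image_group_def)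
  interpret f: group_hom G K f
    unfolding K_def by (rule weak_group_morphism_group_hom[OF w])
  have "order K = card (rcosets Z)"
    using iso_same_order[OF weak_group_morphism_is_iso[OF w]]
    by (simp add: K_def order_def FactGroup_def)
  moreover have "card (rcosets Z) * p = p ^ a * p"
    using lagrange[OF Z] \<open>card Z = p\<close> ord by (simp add: mult.commute)
  ultimately have ordK: "order K = p ^ a" using p(1) by auto
  \<comment> \<open>The induced map on representatives: apply \<psi>, then normalize. It is
    compatible with \<open>f\<close> because \<psi> fixes \<open>z\<close> and so every element of
    \<open>Z\<close>.\<close>
  define \<psi>' where "\<psi>' u = f (\<psi> u)" for u
  have \<psi>': "\<psi>' (f x) = f (\<psi> x)" if x: "x \<in> carrier G" for x
  proof -
    obtain c where c: "c \<in> Z" "f x = c \<otimes> x" using f[OF x] by (auto simp: r_coset_def)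
    then obtain i :: int where "c = z [^] i" by (auto simp: Z_def)
    then have "\<psi> c = c" using z by (simp add: \<psi>.hom_int_pow)
    then have "\<psi> (f x) = c \<otimes> \<psi> x" using c x Z.subset by auto
    moreover have "c \<otimes> \<psi> x \<otimes> inv (\<psi> x) \<in> Z" using c x Z.subset by (simp add: m_assoc subset_iff)
    ultimately show ?thesis
      unfolding \<psi>'_def using c x f_eq[of "c \<otimes> \<psi> x" "\<psi> x"] Z.subset by auto
  qed
  have \<psi>'_pow: "(\<psi>' ^^ n) (f x) = f ((\<psi> ^^ n) x) \<and> (\<psi> ^^ n) x \<in> carrier G"
    if "x \<in> carrier G" for n x
    using that by (induction n) (auto simp: \<psi>')
  have orbit: "((\<lambda>u. \<psi>' u \<otimes>\<^bsub>K\<^esub> f b) ^^ n) \<one>\<^bsub>K\<^esub> = f (((\<lambda>x. \<psi> x \<otimes> b) ^^ n) \<one>)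
      \<and> ((\<lambda>x. \<psi> x \<otimes> b) ^^ n) \<one> \<in> carrier G" for n
    by (induction n) (auto simp: \<psi>' b)
  have "cyclic_group K"
  proof (rule IH[OF f.H.is_group ordK])
    show "\<psi>' \<in> hom K K"
    proof (rule homI)
      fix u v assume "u \<in> carrier K" "v \<in> carrier K"
      then obtain x y where xy: "x \<in> carrier G" "y \<in> carrier G" "u = f x" "v = f y"
        by (auto simp: carK)
      then have "\<psi>' (u \<otimes>\<^bsub>K\<^esub> v) = \<psi>' (f (x \<otimes> y))" by simp
      also have "\<dots> = \<psi>' u \<otimes>\<^bsub>K\<^esub> \<psi>' v" unfolding \<psi>'[OF m_closed[OF xy(1,2)]] using xy \<psi>' by simp
      finally show "\<psi>' (u \<otimes>\<^bsub>K\<^esub> v) = \<psi>' u \<otimes>\<^bsub>K\<^esub> \<psi>' v" .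
    qed (auto simp: carK \<psi>')
    show "f b \<in> carrier K" using b by simp
    fix u assume "u \<in> carrier K"
    then obtain x where x: "x \<in> carrier G" "u = f x" by (auto simp: carK)
    show "(\<psi>' ^^ (p ^ k)) u = u" using \<psi>'_pow[OF x(1)] \<psi>(2)[OF x(1)] x(2) by simp
    show "\<exists>n. ((\<lambda>u. \<psi>' u \<otimes>\<^bsub>K\<^esub> f b) ^^ n) \<one>\<^bsub>K\<^esub> = u"
      using trans[OF x(1)] orbit x(2) by metis
  qed
  then obtain h where h: "h \<in> carrier K" "carrier K = range (\<lambda>i :: int. h [^]\<^bsub>K\<^esub> i)"
    unfolding f.H.cyclic_group by blast
  then obtain g where g: "g \<in> carrier G" "h = f g" by (auto simp: carK)
  have "\<exists>(i :: int) (j :: int). x = g [^] i \<otimes> z [^] j" if x: "x \<in> carrier G" for x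
  proof -
    have "f x \<in> range (\<lambda>i :: int. h [^]\<^bsub>K\<^esub> i)" using x h(2) by (metis f.hom_closed)
    then obtain i :: int where "f x = h [^]\<^bsub>K\<^esub> i" by blast
    then have "f x = f (g [^] i)" using g by (simp add: f.hom_int_pow)
    then have "x \<otimes> inv (g [^] i) \<in> Z" using f_eq[OF x] g(1) by simp
    then obtain j :: int where j: "x \<otimes> inv (g [^] i) = z [^] j" by (auto simp: Z_def)
    then have "x = z [^] j \<otimes> g [^] i" using g(1) x z(1) by (simp add: inv_solve_right')
    moreover have "g [^] i \<otimes> z [^] j \<otimes> inv (g [^] i) = z [^] j"
      using g(1) by (intro conj) (auto simp: Z_def)
    ultimately have "x = g [^] i \<otimes> z [^] j" using g(1) z(1) by (metis int_pow_closed inv_solve_right' m_closed)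
    then show ?thesis by blast
  qed
  from cyclic_p_group_of_central_extension[OF ord p z(1,3,5) \<psi> z(4) g(1) this b trans]
  show ?thesis by blast
qed

text \<open>Restricted to plain monoid records, the type of \<open>image_group\<close>, so that the
  induction applies to the quotient. One further use of the step then covers arbitrary record
  extensions.\<close>

lemma cyclic_p_group_of_transitive_affine_monoid:
  fixes G :: "'a monoid" (structure)
  assumes "group G" "order G = p ^ a" "prime p" "odd p"
    and \<psi>: "\<psi> \<in> hom G G" "\<And>x. x \<in> carrier G \<Longrightarrow> (\<psi> ^^ (p ^ k)) x = x"
    and b: "b \<in> carrier G"
    and trans: "\<And>x. x \<in> carrier G \<Longrightarrow> \<exists>n. ((\<lambda>x. \<psi> x \<otimes> b) ^^ n) \<one> = x"
  shows "cyclic_group G"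
  using assms
proof (induction a arbitrary: G \<psi> b)
  case 0
  then show ?case
    by (intro trivial_imp_cyclic_group) (simp add: group.order_one_triv_iff[symmetric] trivial_group_def)
next
  case (Suc a)
  show ?case
    by (rule group.cyclic_p_group_of_transitive_affine_step[OF Suc.prems(1) Suc.IH Suc.prems(2-)])
      (use Suc.prems in auto)
qed

theorem (in group) cyclic_p_group_of_transitive_affine:
  assumes "order G = p ^ a" "prime p" "odd p"
    and \<psi>: "\<psi> \<in> hom G G" "\<And>x. x \<in> carrier G \<Longrightarrow> (\<psi> ^^ (p ^ k)) x = x"
    and b: "b \<in> carrier G"
    and trans: "\<And>x. x \<in> carrier G \<Longrightarrow> \<exists>n. ((\<lambda>x. \<psi> x \<otimes> b) ^^ n) \<one> = x"
  shows "cyclic_group G"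
proof (cases a)
  case 0
  then show ?thesis
    using assms(1) by (intro trivial_imp_cyclic_group) (simp add: order_one_triv_iff[symmetric] trivial_group_def)
next
  case (Suc a')
  show ?thesis
    by (rule cyclic_p_group_of_transitive_affine_step[where a = a' and p = p and k = k, OF cyclic_p_group_of_transitive_affine_monoid])
      (use assms Suc in auto)
qed

context group
begin

section \<open>Sylow subgroups of groups with a transitive affine map\<close>

lemma cyclic_conjugate_subgroup:
  assumes x: "x \<in> carrier G" and Q: "subgroup Q G" and cyc: "cyclic_group (G\<lparr>carrier := Q\<rparr>)"
  shows "cyclic_group (G\<lparr>carrier := x <# Q #> inv x\<rparr>)"
proof (rule group.cyclic_group_epimorphic_image[OF subgroup_imp_group[OF Q] _ cyc])
  show "Group.group (G\<lparr>carrier := x <# Q #> inv x\<rparr>)"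
    by (rule subgroup_imp_group[OF conjugate_subgroup(1)[OF x Q]])
  interpret c: group_hom G G "\<lambda>y. x \<otimes> y \<otimes> inv x" by (rule conj_hom[OF x])
  show "(\<lambda>y. x \<otimes> y \<otimes> inv x) \<in> epi (G\<lparr>carrier := Q\<rparr>) (G\<lparr>carrier := x <# Q #> inv x\<rparr>)"
    using c.homh subgroup.subset[OF Q]
    by (auto simp: epi_def hom_def conjugate_subgroup(3)[OF x Q] subset_iff)
qed

lemma sylow_subgroup_index:
  assumes "finite (carrier G)" "prime p"
  obtains m where "order G = p ^ multiplicity p (order G) * m" "\<not> p dvd m"
proof -
  have "order G \<noteq> 0" using assms(1) order_gt_0_iff_finite by simp
  then show thesis
    using multiplicity_decompose'[of "order G" p] assms(2) that not_prime_unit by metis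
qed

lemma sylow_cyclic_of_cyclic_sylow:
  assumes "finite (carrier G)" "sylow_subgroup p Q G" "cyclic_group (G\<lparr>carrier := Q\<rparr>)"
    and "sylow_subgroup p P G"
  shows "cyclic_group (G\<lparr>carrier := P\<rparr>)"
proof -
  have p: "prime p" using assms(2) by (simp add: sylow_subgroup_def)
  obtain m where m: "order G = p ^ multiplicity p (order G) * m" "\<not> p dvd m"
    using sylow_subgroup_index[OF assms(1) p] .
  obtain x where "x \<in> carrier G" "P = x <# Q #> inv x"
    using sylow_subgroups_conjugate[OF assms(1) p m, of Q P] assms(2,4)
    by (auto simp: sylow_subgroup_def)
  then show ?thesis
    using cyclic_conjugate_subgroup assms(2,3) by (simp add: sylow_subgroup_def)
qed

text \<open>Composing affine maps multiplies the linear parts, and the translation part of an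
  iterate is its value at the identity. Hence a power of the affine map can again be treated as an
  affine map.\<close>

lemma affine_funpow:
  assumes \<phi>: "\<phi> \<in> hom G G" and a: "a \<in> carrier G" and x: "x \<in> carrier G"
  defines "\<sigma> \<equiv> \<lambda>x. \<phi> x \<otimes> a"
  shows "(\<phi> ^^ i) x \<in> carrier G" "(\<sigma> ^^ i) x \<in> carrier G"
    "(\<sigma> ^^ i) x = (\<phi> ^^ i) x \<otimes> (\<sigma> ^^ i) \<one>"
proof -
  have c: "\<phi> y \<in> carrier G" if "y \<in> carrier G" for y using \<phi> that by (auto simp: hom_def)
  have \<phi>c: "(\<phi> ^^ i) y \<in> carrier G" "(\<sigma> ^^ i) y \<in> carrier G" if "y \<in> carrier G" for i y
    using that by (induction i) (auto simp: c \<sigma>_def a)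
  then show "(\<phi> ^^ i) x \<in> carrier G" "(\<sigma> ^^ i) x \<in> carrier G" using x by auto
  show "(\<sigma> ^^ i) x = (\<phi> ^^ i) x \<otimes> (\<sigma> ^^ i) \<one>"
  proof (induction i)
    case (Suc i)
    have "(\<sigma> ^^ Suc i) x = \<phi> ((\<phi> ^^ i) x \<otimes> (\<sigma> ^^ i) \<one>) \<otimes> a"
      unfolding Suc[symmetric] by (simp add: \<sigma>_def)
    also have "\<dots> = (\<phi> ^^ Suc i) x \<otimes> (\<phi> ((\<sigma> ^^ i) \<one>) \<otimes> a)"
      using \<phi>c x a c by (simp add: hom_mult[OF \<phi>] m_assoc)
    finally show ?case by (simp add: \<sigma>_def)
  qed (use x in simp)
qed

lemma hom_funpow: "\<phi> \<in> hom G G \<Longrightarrow> (\<phi> ^^ i) \<in> hom G G"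
  by (induction i) (auto simp: hom_def Pi_iff)

text \<open>The first \<open>order G\<close> iterates of the identity reach all of the carrier, so
  by counting they are distinct.\<close>

lemma affine_orbit_eq_iff:
  assumes "finite (carrier G)" "\<phi> \<in> hom G G" "a \<in> carrier G"
  defines "\<sigma> \<equiv> \<lambda>x. \<phi> x \<otimes> a"
  assumes trans: "\<And>x. x \<in> carrier G \<Longrightarrow> \<exists>i. (\<sigma> ^^ i) \<one> = x"
    and period: "\<And>x. x \<in> carrier G \<Longrightarrow> (\<sigma> ^^ order G) x = x"
  shows "(\<sigma> ^^ s) \<one> = (\<sigma> ^^ t) \<one> \<longleftrightarrow> [s = t] (mod order G)"
proof -
  let ?n = "order G"
  have n: "?n > 0" using assms(1) order_gt_0_iff_finite by simp
  have c: "(\<sigma> ^^ i) x \<in> carrier G" if "x \<in> carrier G" for i x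
    unfolding \<sigma>_def using affine_funpow(2)[OF assms(2,3) that] .
  have per: "(\<sigma> ^^ (i * ?n)) x = x" if "x \<in> carrier G" for i x
    using that period by (induction i) (auto simp: funpow_add)
  have red: "(\<sigma> ^^ i) \<one> = (\<sigma> ^^ (i mod ?n)) \<one>" for i
  proof -
    have "(\<sigma> ^^ (i mod ?n + i div ?n * ?n)) \<one> = (\<sigma> ^^ (i mod ?n)) \<one>"
      unfolding funpow_add using per by simp
    then show ?thesis by simp
  qed
  have "(\<lambda>i. (\<sigma> ^^ i) \<one>) ` {..<?n} = carrier G"
  proof
    show "carrier G \<subseteq> (\<lambda>i. (\<sigma> ^^ i) \<one>) ` {..<?n}"
    proof
      fix x assume "x \<in> carrier G"
      then obtain i where "(\<sigma> ^^ (i mod ?n)) \<one> = x" using trans red by metis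
      then show "x \<in> (\<lambda>i. (\<sigma> ^^ i) \<one>) ` {..<?n}" using n by force
    qed
  qed (use c in auto)
  then have "inj_on (\<lambda>i. (\<sigma> ^^ i) \<one>) {..<?n}"
    by (intro eq_card_imp_inj_on) (auto simp: order_def)
  then have "(\<sigma> ^^ (s mod ?n)) \<one> = (\<sigma> ^^ (t mod ?n)) \<one> \<longleftrightarrow> s mod ?n = t mod ?n"
    using n by (auto simp: inj_on_def)
  then show ?thesis unfolding cong_def using red[of s] red[of t] by simp
qed

lemma odd_sylow_cyclic_of_transitive_affine:
  assumes fin: "finite (carrier G)" and \<phi>: "\<phi> \<in> hom G G" and a: "a \<in> carrier G"
  defines "\<sigma> \<equiv> \<lambda>x. \<phi> x \<otimes> a"
  assumes trans: "\<And>x. x \<in> carrier G \<Longrightarrow> \<exists>i. (\<sigma> ^^ i) \<one> = x"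
    and period: "\<And>x. x \<in> carrier G \<Longrightarrow> (\<sigma> ^^ order G) x = x"
    and "odd p" and P: "sylow_subgroup p P G"
  shows "cyclic_group (G\<lparr>carrier := P\<rparr>)"
proof -
  have p: "prime p" using P by (simp add: sylow_subgroup_def)
  define m where "m = multiplicity p (order G)"
  obtain q where q: "order G = p ^ m * q" "\<not> p dvd q"
    using sylow_subgroup_index[OF fin p] unfolding m_def .
  have n: "order G > 0" using fin order_gt_0_iff_finite by simp
  then have q0: "q > 0" using q by auto
  \<comment> \<open>Raising to the part \<open>q\<close> of the order prime to \<open>p\<close>
    leaves a map whose \<open>p ^ m\<close>-th iterate is the identity.\<close>
  define \<tau> where "\<tau> = \<sigma> ^^ q"
  define \<psi> where "\<psi> = \<phi> ^^ q"
  define b where "b = \<tau> \<one>"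
  have \<psi>: "\<psi> \<in> hom G G" unfolding \<psi>_def by (rule hom_funpow[OF \<phi>])
  interpret \<psi>: group_hom G G \<psi>
    using \<psi> by (simp add: group_hom_def group_hom_axioms_def is_group)
  have b: "b \<in> carrier G" unfolding b_def \<tau>_def \<sigma>_def by (rule affine_funpow(2)[OF \<phi> a one_closed])
  have \<tau>: "\<tau> x = \<psi> x \<otimes> b" "\<tau> x \<in> carrier G" if "x \<in> carrier G" for x
    unfolding b_def \<tau>_def \<sigma>_def \<psi>_def using affine_funpow(2,3)[OF \<phi> a that] by auto
  have \<tau>_pow: "\<tau> ^^ i = \<sigma> ^^ (q * i)" for i
    unfolding \<tau>_def by (simp add: funpow_mult mult.commute)
  have \<tau>c: "(\<tau> ^^ i) x \<in> carrier G" if "x \<in> carrier G" for i x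
    using that \<tau>(2) by (induction i) auto
  \<comment> \<open>The \<open>p ^ m\<close>-th iterate of \<psi> is the linear part of \<sigma>
    iterated \<open>order G\<close> times. That iterate is the identity and fixes
    \<open>\<one>\<close>, so its linear part is the identity too.\<close>
  have \<psi>_period: "(\<psi> ^^ (p ^ m)) x = x" if x: "x \<in> carrier G" for x
  proof -
    have "(\<sigma> ^^ order G) x = (\<phi> ^^ order G) x \<otimes> (\<sigma> ^^ order G) \<one>"
      unfolding \<sigma>_def by (rule affine_funpow(3)[OF \<phi> a x])
    then have "x = (\<phi> ^^ order G) x"
      using period x affine_funpow(1)[OF \<phi> a x] by simp
    then show ?thesis
      unfolding \<psi>_def q(1) by (simp add: funpow_mult mult.commute)
  qed
  obtain Q where Q: "subgroup Q G" "card Q = p ^ m" "\<psi> ` Q = Q"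
    using sylow_fixed_by_p_automorphism[OF fin p q \<psi> \<psi>_period] by blast
  interpret Q: subgroup Q G by fact
  have \<tau>_coset: "\<tau> ` (Q #> x) = Q #> \<tau> x" if x: "x \<in> carrier G" for x
  proof -
    have *: "\<tau> (c \<otimes> x) = \<psi> c \<otimes> \<tau> x" if "c \<in> Q" for c
      using \<tau> that x b by (simp add: m_assoc)
    have "\<tau> ` (Q #> x) = (\<lambda>c. \<tau> (c \<otimes> x)) ` Q" by (auto simp: r_coset_def)
    also have "\<dots> = (\<lambda>c. c \<otimes> \<tau> x) ` (\<psi> ` Q)" using * by (auto simp: image_image)
    also have "\<dots> = Q #> \<tau> x" unfolding Q(3) by (auto simp: r_coset_def)
    finally show ?thesis .
  qed
  have "[card (rcosets Q) = card {C \<in> rcosets Q. \<tau> ` C = C}] (mod p)"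
  proof (rule p_power_permutation_fixed_points[where k = m, OF p])
    show "finite (rcosets Q)"
      using fin rcosets_subset_PowG[OF Q(1)] by (simp add: finite_subset)
    fix C assume C: "C \<in> rcosets Q"
    then obtain x where x: "x \<in> carrier G" "C = Q #> x" by (auto simp: RCOSETS_def)
    then show "\<tau> ` C \<in> rcosets Q"
      using \<tau>_coset \<tau>(2) by (auto simp: rcosetsI Q.subset)
    have "((`) \<tau> ^^ i) C = (\<tau> ^^ i) ` C" for i by (induction i) (auto simp: image_image)
    moreover have "(\<tau> ^^ (p ^ m)) y = y" if "y \<in> C" for y
      using period that Q.rcosets_carrier[OF is_group C] unfolding \<tau>_pow q(1)
      by (auto simp: mult.commute)
    ultimately show "((`) \<tau> ^^ (p ^ m)) C = C" by simp
  qed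
  moreover have "card (rcosets Q) = q"
    using lagrange[OF Q(1)] Q(2) q(1) p by (simp add: prime_gt_0_nat)
  ultimately have "\<not> p dvd card {C \<in> rcosets Q. \<tau> ` C = C}" using q(2) by (simp add: cong_dvd_iff)
  then have "{C \<in> rcosets Q. \<tau> ` C = C} \<noteq> {}" by (metis card.empty dvd_0_right)
  then obtain x where x: "x \<in> carrier G" "\<tau> ` (Q #> x) = Q #> x"
    by (auto simp: RCOSETS_def)
  then have "\<tau> x \<in> Q #> x" using rcos_self[OF x(1) Q(1)] by blast
  define b' where "b' = \<tau> x \<otimes> inv x"
  have b': "b' \<in> Q"
    unfolding b'_def by (rule Q.rcos_module_imp[OF is_group x(1)]) fact
  \<comment> \<open>The map \<tau> moved by right translation from the fixed coset
    \<open>Q #> x\<close> to \<open>Q\<close>: on the carrier, \<open>\<rho> y\<close> equals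
    \<open>\<tau> (y \<otimes> x) \<otimes> inv x\<close>.\<close>
  define \<rho> where "\<rho> y = \<psi> y \<otimes> b'" for y
  have \<rho>_Suc: "(\<rho> ^^ Suc i) \<one> = \<psi> ((\<rho> ^^ i) \<one>) \<otimes> b'" for i
    unfolding funpow.simps o_apply by (rule \<rho>_def)
  have \<rho>: "(\<rho> ^^ i) \<one> = (\<tau> ^^ i) x \<otimes> inv x \<and> (\<rho> ^^ i) \<one> \<in> Q" for i
  proof (induction i)
    case (Suc i)
    let ?w = "(\<tau> ^^ i) x"
    have w: "?w \<in> carrier G" by (rule \<tau>c[OF x(1)])
    have "(\<rho> ^^ Suc i) \<one> = \<psi> (?w \<otimes> inv x) \<otimes> (\<psi> x \<otimes> b \<otimes> inv x)"
      unfolding \<rho>_Suc using Suc \<tau>(1)[OF x(1)] by (simp add: b'_def)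
    also have "\<dots> = \<psi> ?w \<otimes> (inv (\<psi> x) \<otimes> (\<psi> x \<otimes> (b \<otimes> inv x)))"
      using w x(1) b by (simp add: m_assoc)
    also have "inv (\<psi> x) \<otimes> (\<psi> x \<otimes> (b \<otimes> inv x)) = b \<otimes> inv x"
      using x(1) b by (simp flip: m_assoc)
    also have "\<psi> ?w \<otimes> (b \<otimes> inv x) = (\<tau> ^^ Suc i) x \<otimes> inv x"
      using w x(1) b \<tau>(1)[OF w] by (simp add: m_assoc)
    finally have "(\<rho> ^^ Suc i) \<one> = (\<tau> ^^ Suc i) x \<otimes> inv x" .
    moreover have "(\<rho> ^^ Suc i) \<one> \<in> Q"
      unfolding \<rho>_Suc using Suc Q(3) b' by (intro Q.m_closed) blast+
    ultimately show ?case by blast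
  qed (use x in simp)
  obtain l where l: "(\<sigma> ^^ l) \<one> = x" using trans[OF x(1)] by blast
  \<comment> \<open>In the single cycle of \<sigma>, the point \<open>x\<close> sits at position
    \<open>l\<close> and \<tau> advances by \<open>q\<close>. The first \<open>p ^ m\<close>
    positions are distinct modulo \<open>q * p ^ m\<close>, and so many points fill
    \<open>Q\<close>.\<close>
  have "inj_on (\<lambda>i. (\<rho> ^^ i) \<one>) {..<p ^ m}"
  proof (rule inj_onI)
    fix i j assume ij: "i \<in> {..<p ^ m}" "j \<in> {..<p ^ m}" "(\<rho> ^^ i) \<one> = (\<rho> ^^ j) \<one>"
    have "(\<tau> ^^ i) x \<otimes> inv x = (\<tau> ^^ j) x \<otimes> inv x"
      using ij(3) \<rho>[of i] \<rho>[of j] by argo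
    then have "(\<tau> ^^ i) x = (\<tau> ^^ j) x"
      using \<tau>c[OF x(1)] x(1) by simp
    then have "(\<sigma> ^^ (q * i + l)) \<one> = (\<sigma> ^^ (q * j + l)) \<one>"
      unfolding \<tau>_pow by (simp add: funpow_add l)
    then have "[q * i + l = q * j + l] (mod order G)"
      using affine_orbit_eq_iff[OF fin \<phi> a trans[unfolded \<sigma>_def] period[unfolded \<sigma>_def]]
      unfolding \<sigma>_def by blast
    then have "[q * i = q * j] (mod q * p ^ m)"
      by (simp add: q(1) mult.commute cong_add_rcancel_nat)
    then have "[i = j] (mod p ^ m)"
      using q0 by (simp add: cong_def mod_mult_mult1)
    then show "i = j" using ij by (simp add: cong_def)
  qed
  then have "card ((\<lambda>i. (\<rho> ^^ i) \<one>) ` {..<p ^ m}) = card Q" by (simp add: card_image Q(2))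
  moreover have "finite Q" using Q(1) fin finite_subset subgroup.subset by blast
  ultimately have orbit: "(\<lambda>i. (\<rho> ^^ i) \<one>) ` {..<p ^ m} = Q"
    using \<rho> by (intro card_subset_eq image_subsetI) blast+
  have "cyclic_group (G\<lparr>carrier := Q\<rparr>)"
  proof (rule group.cyclic_p_group_of_transitive_affine[where a = m and p = p and k = m and \<psi> = \<psi> and b = b'])
    show "Group.group (G\<lparr>carrier := Q\<rparr>)" by (rule subgroup_imp_group[OF Q(1)])
    show "\<psi> \<in> hom (G\<lparr>carrier := Q\<rparr>) (G\<lparr>carrier := Q\<rparr>)"
      using Q(3) by (auto intro!: homI)
    fix y assume "y \<in> carrier (G\<lparr>carrier := Q\<rparr>)"
    then have y: "y \<in> Q" by simp
    show "(\<psi> ^^ (p ^ m)) y = y" using \<psi>_period y by simp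
    show "\<exists>n. ((\<lambda>y. \<psi> y \<otimes>\<^bsub>G\<lparr>carrier := Q\<rparr>\<^esub> b') ^^ n) \<one>\<^bsub>G\<lparr>carrier := Q\<rparr>\<^esub> = y"
      using y orbit unfolding \<rho>_def by auto
  qed (use p \<open>odd p\<close> b' Q in \<open>auto simp: order_def\<close>)
  then show ?thesis
    using sylow_cyclic_of_cyclic_sylow[OF fin _ _ P] Q p by (simp add: sylow_subgroup_def m_def)
qed

end

section \<open>Cyclic regular subgroups of the holomorph\<close>

lemma (in group) int_pow_mod_order:
  assumes "finite (carrier G)" "g \<in> carrier G"
  shows "g [^] (i :: int) = g [^] nat (i mod int (order G))"
proof -
  let ?n = "int (order G)"
  have n: "?n > 0" using assms(1) order_gt_0_iff_finite by simp
  have "g [^] i = g [^] (?n * (i div ?n) + i mod ?n)" by simp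
  also have "\<dots> = (g [^] ?n) [^] (i div ?n) \<otimes> g [^] (i mod ?n)"
    by (simp only: int_pow_mult[OF assms(2)] int_pow_pow[OF assms(2)])
  also have "g [^] ?n = \<one>" using pow_order_eq_1[OF assms(2)] by (simp add: int_pow_int)
  also have "\<one> [^] (i div ?n) \<otimes> g [^] (i mod ?n) = g [^] int (nat (i mod ?n))"
    using assms(2) n by simp
  finally show ?thesis by (simp add: int_pow_int)
qed

lemma cyclic_integer_mod_group:
  assumes "n > 0"
  shows "cyclic_group (integer_mod_group n)"
  unfolding group.cyclic_group[OF group_integer_mod_group]
\<comment> \<open>The generator is reduced modulo \<open>n\<close> to cover \<open>n = 1\<close>,
  where the carrier is \<open>{0}\<close>.\<close>
proof (intro bexI[of _ "1 mod int n"] equalityI subsetI)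
  fix i assume "i \<in> carrier (integer_mod_group n)"
  then have "i = (1 mod int n) [^]\<^bsub>integer_mod_group n\<^esub> i"
    using assms by (simp add: carrier_integer_mod_group int_pow_integer_mod_group mod_simps)
  then show "i \<in> range (\<lambda>i :: int. (1 mod int n) [^]\<^bsub>integer_mod_group n\<^esub> i)" by blast
next
  fix i assume "i \<in> range (\<lambda>i :: int. (1 mod int n) [^]\<^bsub>integer_mod_group n\<^esub> i)"
  then show "i \<in> carrier (integer_mod_group n)"
    using assms by (auto simp: carrier_integer_mod_group int_pow_integer_mod_group)
qed (use assms in \<open>simp add: carrier_integer_mod_group\<close>)

lemma mult_holomorph:
  assumes "f \<in> Bij (carrier N)" "g \<in> Bij (carrier N)" "x \<in> carrier N"
  shows "(f \<otimes>\<^bsub>holomorph N\<^esub> g) x = f (g x)"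
  using assms by (simp add: holomorph_def subgroup_generated_def BijGroup_def compose_def)

lemma carrier_holomorph_subset: "carrier (holomorph N) \<subseteq> Bij (carrier N)"
  using group.carrier_subgroup_generated_subset[OF group_BijGroup, of "carrier N"]
  by (simp add: holomorph_def BijGroup_def)

context group
begin

lemma hol_rho_mult:
  assumes "\<eta> \<in> carrier G" "\<theta> \<in> carrier G"
  shows "hol_rho G \<eta> \<otimes>\<^bsub>BijGroup (carrier G)\<^esub> hol_rho G \<theta> = hol_rho G (\<eta> \<otimes> \<theta>)"
proof -
  have "hol_rho G \<eta> \<in> Bij (carrier G)" "hol_rho G \<theta> \<in> Bij (carrier G)"
    using assms hol_rho_in_Bij by (auto simp: BijGroup_def)
  moreover have "compose (carrier G) (hol_rho G \<eta>) (hol_rho G \<theta>) = hol_rho G (\<eta> \<otimes> \<theta>)"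
    using assms by (auto simp: compose_def hol_rho_def m_assoc inv_mult_group)
  ultimately show ?thesis by (simp add: BijGroup_def)
qed

lemma inv_hol_rho:
  assumes "\<eta> \<in> carrier G"
  shows "inv\<^bsub>BijGroup (carrier G)\<^esub> (hol_rho G \<eta>) = hol_rho G (inv \<eta>)"
proof (rule group.inv_equality[OF group_BijGroup])
  show "hol_rho G (inv \<eta>) \<otimes>\<^bsub>BijGroup (carrier G)\<^esub> hol_rho G \<eta> = \<one>\<^bsub>BijGroup (carrier G)\<^esub>"
    using assms by (subst hol_rho_mult) (auto simp: hol_rho_def BijGroup_def)
qed (use assms hol_rho_in_Bij in auto)

text \<open>Both kinds of generators are affine, their inverses are again generators, and a
  composite of affine maps is affine.\<close>

lemma holomorph_affine:
  assumes "f \<in> carrier (holomorph G)"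
  shows "\<exists>\<phi> \<in> hom G G. \<exists>a \<in> carrier G. \<forall>x \<in> carrier G. f x = \<phi> x \<otimes> a"
proof -
  let ?B = "BijGroup (carrier G)"
  let ?S = "hol_rho G ` carrier G \<union> auto G"
  have S: "?S \<subseteq> carrier ?B"
    using hol_rho_in_Bij subgroup.subset[OF subgroup_auto] by auto
  have affine: "\<exists>\<phi> \<in> hom G G. \<exists>a \<in> carrier G. \<forall>x \<in> carrier G. f x = \<phi> x \<otimes> a" if "f \<in> ?S" for f
    using that
  proof
    assume "f \<in> hol_rho G ` carrier G"
    then obtain \<eta> where "\<eta> \<in> carrier G" "f = hol_rho G \<eta>" by blast
    then show ?thesis
      by (intro bexI[of _ "\<lambda>x. x"] bexI[of _ "inv \<eta>"]) (auto simp: hol_rho_def hom_def)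
  next
    assume "f \<in> auto G"
    then show ?thesis
      by (intro bexI[of _ f] bexI[of _ \<one>]) (auto simp: auto_def hom_def Pi_iff)
  qed
  have "f \<in> generate ?B ?S" using assms by (simp add: holomorph_carrier)
  then show ?thesis
  proof (induction rule: generate.induct)
    case one
    then show ?case
      by (intro bexI[of _ "\<lambda>x. x"] bexI[of _ \<one>]) (auto simp: BijGroup_def hom_def)
  next
    case (incl f)
    then show ?case by (rule affine)
  next
    case (inv f)
    then have "inv\<^bsub>?B\<^esub> f \<in> ?S"
      using inv_hol_rho subgroup.m_inv_closed[OF subgroup_auto] by auto
    then show ?case by (rule affine)
  next
    case (eng f g)
    obtain \<phi> a where f: "\<phi> \<in> hom G G" "a \<in> carrier G" "\<And>x. x \<in> carrier G \<Longrightarrow> f x = \<phi> x \<otimes> a"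
      using eng.IH(1) by blast
    obtain \<psi> b where g: "\<psi> \<in> hom G G" "b \<in> carrier G" "\<And>x. x \<in> carrier G \<Longrightarrow> g x = \<psi> x \<otimes> b"
      using eng.IH(2) by blast
    have "f \<in> carrier ?B" "g \<in> carrier ?B"
      using group.generate_incl[OF group_BijGroup S] eng.hyps by blast+
    then have "f \<in> Bij (carrier G)" "g \<in> Bij (carrier G)"
      by (simp_all add: BijGroup_def)
    then have "(f \<otimes>\<^bsub>?B\<^esub> g) x = (\<phi> \<circ> \<psi>) x \<otimes> (\<phi> b \<otimes> a)" if "x \<in> carrier G" for x
      using that f g hom_in_carrier[OF f(1)] hom_in_carrier[OF g(1)]
      by (simp add: BijGroup_def compose_def hom_mult[OF f(1)] m_assoc)
    moreover have "\<phi> \<circ> \<psi> \<in> hom G G" using f(1) g(1) by (auto simp: hom_def Pi_iff)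
    moreover have "\<phi> b \<otimes> a \<in> carrier G" using f(2) g(2) hom_in_carrier[OF f(1)] by simp
    ultimately show ?case by blast
  qed
qed

text \<open>The affine map is a generator of the regular subgroup: surjectivity of evaluation at the
  identity gives transitivity, and the order of the subgroup gives the period.\<close>

lemma realizable_cyclic_imp_affine:
  assumes fin: "finite (carrier G)" and real: "realizable (integer_mod_group (order G)) G"
  obtains \<phi> a where "\<phi> \<in> hom G G" "a \<in> carrier G"
    "\<And>x. x \<in> carrier G \<Longrightarrow> \<exists>i. ((\<lambda>x. \<phi> x \<otimes> a) ^^ i) \<one> = x"
    "\<And>x. x \<in> carrier G \<Longrightarrow> ((\<lambda>x. \<phi> x \<otimes> a) ^^ order G) x = x"
proof -
  have n: "order G > 0" using fin order_gt_0_iff_finite by simp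
  obtain H where H: "subgroup H (holomorph G)" "regular_on H G"
      "integer_mod_group (order G) \<cong> (holomorph G)\<lparr>carrier := H\<rparr>"
    using real by (auto simp: realizable_def)
  define K where "K = (holomorph G)\<lparr>carrier := H\<rparr>"
  interpret K: group K
    unfolding K_def by (rule group.subgroup_imp_group[OF group_holomorph H(1)])
  have carK: "carrier K = H" by (simp add: K_def)
  have HB: "H \<subseteq> Bij (carrier G)" using subgroup.subset[OF H(1)] carrier_holomorph_subset by blast
  have bij: "bij_betw (\<lambda>\<sigma>. \<sigma> \<one>) H (carrier G)" using H(2) by (simp add: regular_on_def)
  then have ordK: "order K = order G" by (simp add: order_def carK bij_betw_same_card)
  have finK: "finite (carrier K)" using n ordK K.order_gt_0_iff_finite by simp
  have "cyclic_group K"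
    using cyclic_integer_mod_group[OF n] H(3)
      isomorphic_group_cyclicity[OF _ group_integer_mod_group K.is_group] by (simp add: K_def)
  then obtain \<sigma> where \<sigma>: "\<sigma> \<in> carrier K" "carrier K = range (\<lambda>i :: int. \<sigma> [^]\<^bsub>K\<^esub> i)"
    unfolding K.cyclic_group by blast
  obtain \<phi> a where \<phi>: "\<phi> \<in> hom G G" "a \<in> carrier G" "\<And>x. x \<in> carrier G \<Longrightarrow> \<sigma> x = \<phi> x \<otimes> a"
    using holomorph_affine[of \<sigma>] \<sigma>(1) subgroup.subset[OF H(1)] carK by blast
  have pow: "(\<sigma> [^]\<^bsub>K\<^esub> i) x = ((\<lambda>x. \<phi> x \<otimes> a) ^^ i) x" if x: "x \<in> carrier G" for i :: nat and x
  proof (induction i)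
    case 0
    have "\<one>\<^bsub>K\<^esub> x = x"
      using x by (simp add: K_def holomorph_def subgroup_generated_def BijGroup_def)
    then show ?case by simp
  next
    case (Suc i)
    have "\<sigma> [^]\<^bsub>K\<^esub> Suc i = \<sigma> \<otimes>\<^bsub>K\<^esub> \<sigma> [^]\<^bsub>K\<^esub> i"
      using \<sigma>(1) by (simp add: K.nat_pow_comm K.group_commutes_pow)
    moreover have "\<sigma> \<in> Bij (carrier G)" "\<sigma> [^]\<^bsub>K\<^esub> i \<in> Bij (carrier G)"
      using \<sigma>(1) K.nat_pow_closed[OF \<sigma>(1)] HB carK by auto
    ultimately have "(\<sigma> [^]\<^bsub>K\<^esub> Suc i) x = \<sigma> (((\<lambda>x. \<phi> x \<otimes> a) ^^ i) x)"
      using mult_holomorph[of \<sigma> G "\<sigma> [^]\<^bsub>K\<^esub> i" x] x Suc by (simp add: K_def)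
    then show ?case using \<phi>(3) affine_funpow(2)[OF \<phi>(1,2) x, of i] by simp
  qed
  show thesis
  proof (rule that[OF \<phi>(1,2)])
    fix x assume x: "x \<in> carrier G"
    then have "x \<in> (\<lambda>\<sigma>. \<sigma> \<one>) ` H" using bij by (simp add: bij_betw_def)
    then obtain \<tau> where \<tau>: "\<tau> \<in> H" "\<tau> \<one> = x" by blast
    then obtain i :: int where "\<tau> = \<sigma> [^]\<^bsub>K\<^esub> i" using \<sigma>(2) carK by auto
    then have "\<tau> = \<sigma> [^]\<^bsub>K\<^esub> nat (i mod int (order K))"
      using K.int_pow_mod_order[OF finK \<sigma>(1)] by simp
    then show "\<exists>i. ((\<lambda>x. \<phi> x \<otimes> a) ^^ i) \<one> = x" using \<tau>(2) pow[OF one_closed] by metis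
    have "(\<sigma> [^]\<^bsub>K\<^esub> order G) x = \<one>\<^bsub>K\<^esub> x"
      using K.pow_order_eq_1[OF \<sigma>(1)] ordK by simp
    then show "((\<lambda>x. \<phi> x \<otimes> a) ^^ order G) x = x"
      using pow[OF x, of "order G"] pow[OF x, of 0] by simp
  qed
qed

lemma C_group_of_realizable_cyclic:
  assumes fin: "finite (carrier G)" and "\<not> 4 dvd order G"
    and real: "realizable (integer_mod_group (order G)) G"
  shows "C_group G"
  unfolding C_group_def
proof (intro conjI allI impI is_group fin)
  fix p P assume P: "sylow_subgroup p P G"
  have p: "prime p" and PG: "subgroup P G" and cardP: "card P = p ^ multiplicity p (order G)"
    using P by (auto simp: sylow_subgroup_def)
  show "cyclic_group (G\<lparr>carrier := P\<rparr>)"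
  proof (cases "odd p")
    case True
    obtain \<phi> a where \<phi>: "\<phi> \<in> hom G G" "a \<in> carrier G"
      "\<And>x. x \<in> carrier G \<Longrightarrow> \<exists>i. ((\<lambda>x. \<phi> x \<otimes> a) ^^ i) \<one> = x"
      "\<And>x. x \<in> carrier G \<Longrightarrow> ((\<lambda>x. \<phi> x \<otimes> a) ^^ order G) x = x"
      using realizable_cyclic_imp_affine[OF fin real] by blast
    then show ?thesis using odd_sylow_cyclic_of_transitive_affine[OF fin] True P by blast
  next
    case False
    then have "p = 2" using p by (metis primes_dvd_imp_eq two_is_prime_nat)
    have "multiplicity 2 (order G) < 2"
    proof (rule ccontr)
      assume "\<not> multiplicity 2 (order G) < 2"
      then have "2 ^ 2 dvd order G" using multiplicity_dvd' by (metis not_less)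
      then show False using assms(2) by simp
    qed
    then have "card P = 1 \<or> card P = 2"
      using cardP \<open>p = 2\<close> by (auto simp: less_2_cases_iff)
    \<comment> \<open>The nontrivial element if there is one, and \<open>\<one>\<close> otherwise;
      either way \<open>P\<close> consists of the powers of \<open>x\<close> with exponents 0 and
      1.\<close>
    then obtain x where x: "x \<in> P" "P \<subseteq> {\<one>, x}"
      using subgroup.one_closed[OF PG] by (fastforce simp: card_1_singleton_iff card_2_iff)
    interpret P: group "G\<lparr>carrier := P\<rparr>" by (rule subgroup_imp_group[OF PG])
    have "P \<subseteq> range (\<lambda>i :: int. x [^]\<^bsub>G\<lparr>carrier := P\<rparr>\<^esub> i)"
    proof
      fix y assume "y \<in> P"
      then have "y = x [^]\<^bsub>G\<lparr>carrier := P\<rparr>\<^esub> (0 :: int) \<or> y = x [^]\<^bsub>G\<lparr>carrier := P\<rparr>\<^esub> (1 :: int)"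
        using x P.int_pow_1[of x] by auto
      then show "y \<in> range (\<lambda>i :: int. x [^]\<^bsub>G\<lparr>carrier := P\<rparr>\<^esub> i)" by blast
    qed
    moreover have "range (\<lambda>i :: int. x [^]\<^bsub>G\<lparr>carrier := P\<rparr>\<^esub> i) \<subseteq> P"
      using P.int_pow_closed[of x] x by auto
    ultimately show ?thesis unfolding P.cyclic_group using x by auto
  qed
qed

section \<open>The structure of \<open>C\<close>-groups\<close>

text \<open>The exponents that land in \<open>H\<close> form an ideal of the integers, and its
  generator \<open>d\<close> yields a generator of \<open>H\<close>; \<open>d\<close> is 0 when no
  positive exponent lands in \<open>H\<close>.\<close>

lemma cyclic_subgroup_of_cyclic:
  assumes "cyclic_group G" and H: "subgroup H G"
  shows "cyclic_group (G\<lparr>carrier := H\<rparr>)"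
proof -
  interpret H: group "G\<lparr>carrier := H\<rparr>" by (rule subgroup_imp_group[OF H])
  obtain x where x: "x \<in> carrier G" "carrier G = range (\<lambda>i :: int. x [^] i)"
    using assms(1) unfolding cyclic_group by blast
  define I where "I = {i :: int. x [^] i \<in> H}"
  have I_mult: "i * j \<in> I" if "i \<in> I" for i j :: int
    using that subgroup_int_pow_closed[OF H, of "x [^] i" j] x(1) by (simp add: I_def int_pow_pow)
  have I_diff: "i - j \<in> I" if "i \<in> I" "j \<in> I" for i j :: int
    using that H x(1) by (simp add: I_def int_pow_diff subgroup.m_closed subgroup.m_inv_closed)
  have "\<exists>d \<in> I. \<forall>i \<in> I. d dvd i"
  proof (cases "\<exists>k. k > 0 \<and> int k \<in> I")
    case True
    define d where "d = (LEAST k. k > 0 \<and> int k \<in> I)"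
    have d: "d > 0" "int d \<in> I" using LeastI_ex[OF True] by (simp_all add: d_def)
    have "int d dvd i" if "i \<in> I" for i
    proof (rule ccontr)
      assume "\<not> int d dvd i"
      then have "i mod int d \<noteq> 0" by (simp add: dvd_eq_mod_eq_0)
      then have pos: "i mod int d > 0" "i mod int d < int d"
        using d(1) pos_mod_bound[of "int d" i] pos_mod_sign[of "int d" i] by linarith+
      have "i mod int d = i - int d * (i div int d)" by (simp add: minus_mult_div_eq_mod)
      then have "i mod int d \<in> I" using I_diff[OF that I_mult[OF d(2)]] by simp
      then have "nat (i mod int d) > 0 \<and> int (nat (i mod int d)) \<in> I" using pos by simp
      then have "(LEAST k. k > 0 \<and> int k \<in> I) \<le> nat (i mod int d)" by (rule Least_le)
      then have "d \<le> nat (i mod int d)" by (simp only: d_def)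
      then show False using pos by linarith
    qed
    with d(2) show ?thesis by blast
  next
    case False
    have "i = 0" if "i \<in> I" for i
    proof (rule ccontr)
      assume "i \<noteq> 0"
      have "\<bar>i\<bar> \<in> I" using that I_mult[OF that, of "-1"] by (simp add: abs_if)
      then show False using False \<open>i \<noteq> 0\<close> by (metis int_nat_eq abs_ge_zero zero_less_abs_iff zero_less_nat_eq)
    qed
    moreover have "0 \<in> I" using H by (simp add: I_def subgroup.one_closed)
    ultimately show ?thesis by auto
  qed
  then obtain d where d: "d \<in> I" "\<And>i. i \<in> I \<Longrightarrow> d dvd i" by blast
  have xd: "x [^] d \<in> H" using d(1) by (simp add: I_def)
  have "H \<subseteq> range (\<lambda>i :: int. (x [^] d) [^] i)"
  proof
    fix h assume h: "h \<in> H"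
    then obtain i where i: "h = x [^] (i :: int)"
      using x(2) subgroup.mem_carrier[OF H] by blast
    then have "i \<in> I" using h by (simp add: I_def)
    then obtain j where "i = d * j" using d(2) by blast
    then have "h = (x [^] d) [^] j" using i x(1) by (simp add: int_pow_pow)
    then show "h \<in> range (\<lambda>i :: int. (x [^] d) [^] i)" by blast
  qed
  moreover have "(x [^] d) [^] i = (x [^] d) [^]\<^bsub>G\<lparr>carrier := H\<rparr>\<^esub> i" for i :: int
    by (rule int_pow_consistent[OF H xd])
  moreover have "range (\<lambda>i :: int. (x [^] d) [^] i) \<subseteq> H"
    using subgroup_int_pow_closed[OF H xd] by auto
  ultimately show ?thesis
    unfolding H.cyclic_group using xd by (intro bexI[of _ "x [^] d"]) auto
qed

lemma C_group_p_subgroup: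
  assumes C: "C_group G" and p: "prime p" and R: "subgroup R G" "card R = p ^ k"
  shows "\<exists>P. sylow_subgroup p P G \<and> R \<subseteq> P" "cyclic_group (G\<lparr>carrier := R\<rparr>)"
proof -
  have fin: "finite (carrier G)" using C by (simp add: C_group_def)
  define a where "a = multiplicity p (order G)"
  obtain m where m: "order G = p ^ a * m" "\<not> p dvd m"
    using sylow_subgroup_index[OF fin p] unfolding a_def .
  obtain Q where Q: "subgroup Q G" "card Q = p ^ a"
    using sylow_thm[OF p is_group m(1) fin] by blast
  obtain x where x: "x \<in> carrier G" "\<And>r. r \<in> R \<Longrightarrow> x \<otimes> r \<otimes> inv x \<in> Q"
    using p_subgroup_conjugate_in_sylow[OF fin p m Q R] by blast
  define P where "P = inv x <# Q #> inv (inv x)"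
  have P: "sylow_subgroup p P G"
    using conjugate_subgroup(1,2)[OF inv_closed[OF x(1)] Q(1)] p Q(2)
    by (simp add: sylow_subgroup_def P_def a_def)
  have RP: "R \<subseteq> P"
  proof
    fix r assume r: "r \<in> R"
    then have rc: "r \<in> carrier G" using subgroup.mem_carrier[OF R(1)] by blast
    have "r = inv x \<otimes> (x \<otimes> r \<otimes> inv x) \<otimes> inv (inv x)"
      using rc x(1) by (simp add: m_assoc flip: m_assoc[of "inv x" x])
    then show "r \<in> P"
      unfolding P_def conjugate_subgroup(3)[OF inv_closed[OF x(1)] Q(1)] using x(2)[OF r] by blast
  qed
  with P show "\<exists>P. sylow_subgroup p P G \<and> R \<subseteq> P" by blast
  have PG: "subgroup P G" using P by (simp add: sylow_subgroup_def)
  have "cyclic_group (G\<lparr>carrier := P\<rparr>)" using C P by (simp add: C_group_def)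
  moreover have "subgroup R (G\<lparr>carrier := P\<rparr>)"
    using subgroup_incl[OF R(1) PG RP] .
  ultimately show "cyclic_group (G\<lparr>carrier := R\<rparr>)"
    using group.cyclic_subgroup_of_cyclic[OF subgroup_imp_group[OF PG]] by fastforce
qed

text \<open>A Sylow subgroup of \<open>H\<close> is a \<open>p\<close>-subgroup of \<open>G\<close>,
  hence lies in a cyclic Sylow subgroup of \<open>G\<close>.\<close>

lemma C_group_subgroup:
  assumes C: "C_group G" and H: "subgroup H G"
  shows "C_group (G\<lparr>carrier := H\<rparr>)"
  unfolding C_group_def
proof (intro conjI allI impI)
  show "Group.group (G\<lparr>carrier := H\<rparr>)" by (rule subgroup_imp_group[OF H])
  show "finite (carrier (G\<lparr>carrier := H\<rparr>))"
    using C subgroup.subset[OF H] by (auto simp: C_group_def intro: finite_subset)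
  fix p P assume P: "sylow_subgroup p P (G\<lparr>carrier := H\<rparr>)"
  then have "subgroup P G" using incl_subgroup[OF H] by (simp add: sylow_subgroup_def)
  then show "cyclic_group (G\<lparr>carrier := H\<rparr>\<lparr>carrier := P\<rparr>)"
    using C_group_p_subgroup(2)[OF C] P by (auto simp: sylow_subgroup_def)
qed

lemma C_group_sylow_generator:
  assumes C: "C_group G" and p: "prime p"
  obtains g where "g \<in> carrier G" "ord g = p ^ multiplicity p (order G)"
proof -
  have fin: "finite (carrier G)" using C by (simp add: C_group_def)
  define a where "a = multiplicity p (order G)"
  obtain m where m: "order G = p ^ a * m" "\<not> p dvd m"
    using sylow_subgroup_index[OF fin p] unfolding a_def .
  obtain Q where Q: "subgroup Q G" "card Q = p ^ a"
    using sylow_thm[OF p is_group m(1) fin] by blast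
  interpret Q: group "G\<lparr>carrier := Q\<rparr>" by (rule subgroup_imp_group[OF Q(1)])
  have "cyclic_group (G\<lparr>carrier := Q\<rparr>)" using C_group_p_subgroup(2)[OF C p Q] .
  then obtain g where g: "g \<in> Q" "Q = range (\<lambda>i :: int. g [^]\<^bsub>G\<lparr>carrier := Q\<rparr>\<^esub> i)"
    unfolding Q.cyclic_group by auto
  then have "Q = range (\<lambda>i :: int. g [^] i)"
    using int_pow_consistent[OF Q(1) g(1)] by simp
  moreover have gc: "g \<in> carrier G" using subgroup.mem_carrier[OF Q(1) g(1)] .
  ultimately have "ord g = card Q"
    using generate_pow_card[OF gc] generate_pow[OF gc] by (simp add: full_SetCompr_eq)
  then show thesis using that gc Q(2) by (simp add: a_def)
qed

section \<open>Fusion and transfer for a cyclic Sylow subgroup\<close>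

text \<open>If \<open>p\<close> divides \<open>i\<close>, comparing orders shows that it divides
  \<open>j\<close>. Otherwise \<open>s\<close> normalizes the powers of \<open>g\<close>, acting by
  some exponent \<open>u\<close> with \<open>u ^ order G\<close> congruent to 1 modulo
  \<open>p\<close>, and \<open>cop\<close> forces \<open>u\<close> to be 1. This makes the transfer
  below unambiguous modulo \<open>p\<close>.\<close>

lemma conj_cyclic_p_power_exponents:
  assumes g: "g \<in> carrier G" "ord g = p ^ a" and p: "prime p"
    and cop: "coprime (order G) (p - 1)" and fin: "finite (carrier G)"
    and s: "s \<in> carrier G" "s \<otimes> g [^] (i :: int) \<otimes> inv s = g [^] (j :: int)" and a: "a > 0"
  shows "[i = j] (mod int p)"
proof (cases "int p dvd i")
  case True
  let ?q = "int (p ^ (a - 1))"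
  have pa: "int (ord g) = int p * ?q" using g(2) a by (simp add: power_eq_if)
  have "(g [^] j) [^] ?q = s \<otimes> (g [^] i) [^] ?q \<otimes> inv s"
    unfolding s(2)[symmetric] using conj_int_pow[OF s(1) int_pow_closed[OF g(1)], of i ?q] by simp
  also have "(g [^] i) [^] ?q = \<one>"
    using True g(1) pa by (simp add: int_pow_pow int_pow_eq_id)
  finally have "g [^] (j * ?q) = \<one>" using s(1) g(1) by (simp add: int_pow_pow)
  then have "int p * ?q dvd j * ?q" using int_pow_eq_id[OF g(1)] pa by simp
  then have "int p dvd j" using p by (simp add: prime_gt_0_nat)
  then show ?thesis using True by (metis cong_0_iff cong_sym cong_trans)
next
  case False
  then have "coprime i (int p ^ a)"
    using p by (metis coprime_commute coprime_power_left_iff prime_imp_coprime prime_nat_int_transfer)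
  then obtain c where c: "[i * c = 1] (mod int p ^ a)" using cong_solve_coprime_int by blast
  have gc: "g [^] (i * c) = g"
    using int_pow_eq[OF g(1), of "i * c" 1] c g by (simp add: cong_iff_dvd_diff dvd_diff_commute)
  define u where "u = j * c"
  have u: "s \<otimes> g \<otimes> inv s = g [^] u"
  proof -
    have "s \<otimes> g \<otimes> inv s = s \<otimes> (g [^] i) [^] c \<otimes> inv s" using gc g(1) by (simp add: int_pow_pow)
    also have "\<dots> = (s \<otimes> g [^] i \<otimes> inv s) [^] c"
      by (rule conj_int_pow[OF s(1) int_pow_closed[OF g(1)]])
    finally show ?thesis unfolding s(2) using g(1) by (simp add: int_pow_pow u_def)
  qed
  have "s [^] k \<otimes> g \<otimes> inv (s [^] k) = g [^] (u ^ k)" for k :: nat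
  proof (induction k)
    case (Suc k)
    have "s [^] Suc k = s \<otimes> s [^] k" using s(1) by (simp add: nat_pow_comm group_commutes_pow)
    then have "s [^] Suc k \<otimes> g \<otimes> inv (s [^] Suc k) = s \<otimes> (s [^] k \<otimes> g \<otimes> inv (s [^] k)) \<otimes> inv s"
      using s(1) g(1) by (simp add: m_assoc inv_mult_group)
    also have "\<dots> = (s \<otimes> g \<otimes> inv s) [^] (u ^ k)"
      unfolding Suc by (rule conj_int_pow[OF s(1) g(1)])
    finally show ?case unfolding u using g(1) by (simp add: int_pow_pow)
  qed (use g(1) in simp)
  from this[of "order G"] have "g [^] (u ^ order G) = g [^] (1 :: int)"
    using pow_order_eq_1[OF s(1)] g(1) by simp
  then have "int (ord g) dvd 1 - u ^ order G"
    using int_pow_eq[OF g(1)] by blast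
  then have "int p dvd 1 - u ^ order G"
    unfolding g(2) using a by (metis dvd_power dvd_trans of_nat_dvd_iff)
  then have "[u ^ order G = 1] (mod int p)" by (simp add: cong_iff_dvd_diff dvd_diff_commute)
  then have u1: "[u = 1] (mod int p)"
    using cong_one_of_coprime_power[OF p cop] fin order_gt_0_iff_finite by blast
  have "[i * c = 1] (mod int p)"
    using c a by (meson cong_modulus_mult dvd_power cong_dvd_modulus)
  then have "[j * (i * c) = j * 1] (mod int p)" by (rule cong_mult[OF cong_refl])
  moreover have "[i * u = i * 1] (mod int p)" using u1 by (rule cong_mult[OF cong_refl])
  ultimately show ?thesis
    by (simp add: u_def mult.left_commute mult.assoc) (metis cong_sym cong_trans mult.left_commute)
qed

text \<open>The transfer of \<open>G\<close> into a cyclic Sylow subgroup \<open>P = \<langle>g\<rangle>\<close> for the smallest prime divisor,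
  reduced modulo \<open>p\<close>. It is computed from a potential \<open>E\<close> on \<open>G\<close> that increases by one modulo \<open>p\<close>
  under multiplication by \<open>g\<close> on either side, so that \<open>g\<close> is visibly sent to the index of \<open>P\<close>.\<close>

lemma not_perfect_of_cyclic_sylow:
  assumes fin: "finite (carrier G)" and p: "prime p" "coprime (order G) (p - 1)"
    and ord: "order G = p ^ a * m" "\<not> p dvd m" and a: "a > 0"
    and g: "g \<in> carrier G" "ord g = p ^ a"
  shows "derived G (carrier G) \<noteq> carrier G"
proof -
  define P where "P = range (\<lambda>i :: int. g [^] i)"
  have P: "subgroup P G" unfolding P_def by (rule subgroup_of_powers[OF g(1)])
  interpret P: subgroup P G by fact
  have cardP: "card P = p ^ a"
    using generate_pow_card[OF g(1)] generate_pow[OF g(1)] g(2) by (simp add: P_def full_SetCompr_eq)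
  \<comment> \<open>The double coset of \<open>x\<close> modulo \<open>P\<close> on both
    sides.\<close>
  define D where "D x = {g [^] i \<otimes> x \<otimes> g [^] j | (i :: int) (j :: int). True}" for x
  have D_self: "x \<in> D x" if "x \<in> carrier G" for x
    unfolding D_def using that by (intro CollectI exI[of _ "0 :: int"]) simp
  have D_mult: "g [^] k \<otimes> (g [^] i \<otimes> x \<otimes> g [^] j) \<otimes> g [^] l = g [^] (k + i) \<otimes> x \<otimes> g [^] (j + l)"
    if "x \<in> carrier G" for x and i j k l :: int
    using that g(1) by (simp add: m_assoc int_pow_mult)
  have D_sub: "D (g [^] i \<otimes> x \<otimes> g [^] j) \<subseteq> D x" if "x \<in> carrier G" for x and i j :: int
    unfolding D_def using D_mult[OF that] by blast
  have D_eq: "D (g [^] i \<otimes> x \<otimes> g [^] j) = D x" if x: "x \<in> carrier G" for x and i j :: int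
  proof
    let ?y = "g [^] i \<otimes> x \<otimes> g [^] j"
    have "x = g [^] (-i) \<otimes> ?y \<otimes> g [^] (-j)" unfolding D_mult[OF x] using x by simp
    then show "D x \<subseteq> D ?y" using D_sub[of ?y "-i" "-j"] x g(1) by simp
  qed (rule D_sub[OF x])
  define rep where "rep x = (SOME y. y \<in> D x)" for x
  have rep: "rep x \<in> carrier G \<and> (\<exists>(i :: int) (j :: int). x = g [^] i \<otimes> rep x \<otimes> g [^] j)"
    if x: "x \<in> carrier G" for x
  proof -
    have "rep x \<in> D x" unfolding rep_def using D_self[OF x] by (rule someI)
    then obtain i j :: int where ij: "rep x = g [^] i \<otimes> x \<otimes> g [^] j" by (auto simp: D_def)
    then have "x = g [^] (-i) \<otimes> rep x \<otimes> g [^] (-j)"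
      unfolding ij D_mult[OF x] using x by simp
    moreover have "rep x \<in> carrier G" using ij x g(1) by simp
    ultimately show ?thesis by blast
  qed
  \<comment> \<open>The total exponent of \<open>g\<close> in some expression of \<open>x\<close>
    through the representative of its double coset. Two expressions differ by a conjugation between
    powers of \<open>g\<close>, so the value is well defined modulo \<open>p\<close>.\<close>
  define E where "E x = (SOME k. \<exists>(i :: int) (j :: int). x = g [^] i \<otimes> rep x \<otimes> g [^] j \<and> k = i + j)" for x
  have E: "[E x = i + j] (mod int p)"
    if x: "x \<in> carrier G" and eq: "x = g [^] i \<otimes> rep x \<otimes> g [^] j" for x and i j :: int
  proof -
    have "\<exists>(i' :: int) (j' :: int). x = g [^] i' \<otimes> rep x \<otimes> g [^] j' \<and> E x = i' + j'"
      unfolding E_def by (rule someI[of _ "i + j"]) (use eq in blast)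
    then obtain i' j' :: int where E': "x = g [^] i' \<otimes> rep x \<otimes> g [^] j'" "E x = i' + j'" by blast
    let ?t = "rep x"
    have t: "?t \<in> carrier G" using rep[OF x] by blast
    have "g [^] (i - i') \<otimes> ?t \<otimes> g [^] (j - j') = g [^] (- i') \<otimes> (g [^] i \<otimes> ?t \<otimes> g [^] j) \<otimes> g [^] (- j')"
      unfolding D_mult[OF t] by simp
    also have "\<dots> = g [^] (- i') \<otimes> (g [^] i' \<otimes> ?t \<otimes> g [^] j') \<otimes> g [^] (- j')"
      using eq E'(1) by simp
    also have "\<dots> = ?t" unfolding D_mult[OF t] using t by simp
    finally have "g [^] (i - i') \<otimes> ?t = ?t \<otimes> inv (g [^] (j - j'))"
      using t g(1) by (metis int_pow_closed inv_solve_right m_closed)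
    then have "inv ?t \<otimes> g [^] (i - i') \<otimes> inv (inv ?t) = g [^] (j' - j)"
      using t g(1) by (simp add: m_assoc inv_solve_left' flip: int_pow_neg)
    then have "[i - i' = j' - j] (mod int p)"
      using conj_cyclic_p_power_exponents[OF g p fin inv_closed[OF t]] a by blast
    then have "[i - i' + (i' + j) = j' - j + (i' + j)] (mod int p)" by (rule cong_add) simp
    then show ?thesis using E'(2) by (simp add: cong_sym add.commute)
  qed
  have E_mult: "[E (g [^] k \<otimes> x \<otimes> g [^] l) = k + E x + l] (mod int p)"
    if x: "x \<in> carrier G" for x and k l :: int
  proof -
    let ?y = "g [^] k \<otimes> x \<otimes> g [^] l"
    have rep_y: "rep ?y = rep x" using D_eq[OF x] by (simp add: rep_def)
    obtain i j :: int where ij: "x = g [^] i \<otimes> rep x \<otimes> g [^] j" using rep[OF x] by blast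
    have t: "rep x \<in> carrier G" using rep[OF x] by blast
    have y: "?y \<in> carrier G" using x g(1) by simp
    have "?y = g [^] (k + i) \<otimes> rep ?y \<otimes> g [^] (j + l)"
      unfolding rep_y D_mult[OF t, symmetric] using ij by simp
    then have "[E ?y = (k + i) + (j + l)] (mod int p)" by (rule E[OF y])
    moreover have "[k + E x + l = k + (i + j) + l] (mod int p)"
      using E[OF x ij] by (intro cong_add) auto
    ultimately show ?thesis by (simp add: cong_def algebra_simps)
  qed
  \<comment> \<open>Left multiplication by a power of \<open>g\<close> shifts both terms equally, so
    modulo \<open>p\<close> this difference depends only on the coset \<open>P #> x\<close>.\<close>
  define d where "d y x = E (x \<otimes> y) - E x" for y x
  have d: "[d y x' = d y x] (mod int p)" if x: "x \<in> carrier G" and y: "y \<in> carrier G" and x': "x' \<in> P #> x" for x x' y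
  proof -
    obtain k :: int where k: "x' = g [^] k \<otimes> x" using x' by (auto simp: r_coset_def P_def)
    have "[E (x' \<otimes> y) = k + E (x \<otimes> y)] (mod int p)" "[E x' = k + E x] (mod int p)"
      using E_mult[of "x \<otimes> y" k 0] E_mult[of x k 0] x y g(1) k by (simp_all add: m_assoc)
    then have "[E (x' \<otimes> y) - E x' = (k + E (x \<otimes> y)) - (k + E x)] (mod int p)" by (rule cong_diff)
    then show ?thesis by (simp add: d_def)
  qed
  define r where "r C = (SOME x. x \<in> C)" for C :: "'a set"
  have r: "r C \<in> C" "r C \<in> carrier G" "C = P #> r C" if C: "C \<in> rcosets P" for C
  proof -
    show "r C \<in> C" unfolding r_def using P.rcosets_non_empty[OF C] by (simp add: some_in_eq)
    then show "r C \<in> carrier G" using P.rcosets_carrier[OF is_group C] by blast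
    obtain x where "x \<in> carrier G" "C = P #> x" using C by (auto simp: RCOSETS_def)
    then show "C = P #> r C" using \<open>r C \<in> C\<close> repr_independence P by blast
  qed
  \<comment> \<open>The transfer of \<open>y\<close> in additive form: the potentials of the
    representatives, summed over the permuted cosets, cancel and leave the exponents of the usual
    transfer factors.\<close>
  define V where "V y = (\<Sum>C\<in>rcosets P. d y (r C))" for y
  have V_mult: "[V (y \<otimes> z) = V y + V z] (mod int p)" if y: "y \<in> carrier G" and z: "z \<in> carrier G" for y z
  proof -
    have coset: "C #> w \<in> rcosets P" if C: "C \<in> rcosets P" and w: "w \<in> carrier G" for C w
    proof -
      obtain x where "x \<in> carrier G" "C = P #> x" using C by (auto simp: RCOSETS_def)
      then show ?thesis using w by (simp add: coset_mult_assoc P.subset rcosetsI)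
    qed
    have cancel: "C #> w #> inv w = C" "C #> inv w #> w = C" if C: "C \<in> rcosets P" and w: "w \<in> carrier G" for C w
      using P.rcosets_carrier[OF is_group C] w by (simp_all add: coset_mult_assoc)
    have "bij_betw (\<lambda>C. C #> y) (rcosets P) (rcosets P)"
      by (rule bij_betw_byWitness[where f' = "\<lambda>C. C #> inv y"]) (use coset cancel y in auto)
    then have reindex: "(\<Sum>C\<in>rcosets P. d z (r (C #> y))) = V z"
      unfolding V_def by (rule sum.reindex_bij_betw)
    have "d (y \<otimes> z) (r C) = d z (r C \<otimes> y) + d y (r C)" if "C \<in> rcosets P" for C
      using r(2)[OF that] y z by (simp add: d_def m_assoc)
    then have "V (y \<otimes> z) = (\<Sum>C\<in>rcosets P. d z (r C \<otimes> y)) + V y"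
      unfolding V_def by (simp add: sum.distrib)
    moreover have "[(\<Sum>C\<in>rcosets P. d z (r C \<otimes> y)) = (\<Sum>C\<in>rcosets P. d z (r (C #> y)))] (mod int p)"
    proof (rule cong_sum)
      fix C assume C: "C \<in> rcosets P"
      have C': "C #> y \<in> rcosets P" by (rule coset[OF C y])
      have "r C \<otimes> y \<in> C #> y" using r(1)[OF C] by (auto simp: r_coset_def)
      then have "r C \<otimes> y \<in> P #> r (C #> y)" using r(3)[OF C'] by simp
      then show "[d z (r C \<otimes> y) = d z (r (C #> y))] (mod int p)"
        by (rule d[OF r(2)[OF C'] z])
    qed
    ultimately have "[V (y \<otimes> z) = V z + V y] (mod int p)"
      unfolding reindex by (metis cong_add_rcancel)
    then show ?thesis by (simp add: add.commute)
  qed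
  have "[V g = (\<Sum>C\<in>rcosets P. 1)] (mod int p)"
    unfolding V_def
  proof (rule cong_sum)
    fix C assume "C \<in> rcosets P"
    then have x: "r C \<in> carrier G" by (rule r(2))
    have "[E (r C \<otimes> g) = E (r C) + 1] (mod int p)"
      using E_mult[OF x, of 0 1] x g(1) by simp
    then have "[E (r C \<otimes> g) - E (r C) = E (r C) + 1 - E (r C)] (mod int p)"
      by (rule cong_diff) simp
    then show "[d g (r C) = 1] (mod int p)" by (simp add: d_def)
  qed
  moreover have "card (rcosets P) = m"
    using lagrange[OF P] cardP ord(1) p(1) by (simp add: prime_gt_0_nat)
  ultimately have "[V g = int m] (mod int p)" by simp
  then have Vg: "V g mod int p \<noteq> 0"
    using ord(2) by (metis cong_def dvd_eq_mod_eq_0 of_nat_dvd_iff)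
  define h where "h y = V y mod int p" for y
  let ?Z = "integer_mod_group p"
  have "h \<in> hom G ?Z"
  proof (rule homI)
    fix y z assume "y \<in> carrier G" "z \<in> carrier G"
    then show "h (y \<otimes> z) = h y \<otimes>\<^bsub>?Z\<^esub> h z"
      using V_mult by (simp add: h_def cong_def mod_add_eq)
  qed (use p(1) in \<open>simp add: h_def carrier_integer_mod_group prime_gt_0_nat\<close>)
  then interpret h: group_hom G ?Z h
    by (simp add: group_hom_def group_hom_axioms_def is_group)
  interpret Z: comm_group ?Z by simp
  have "h ` derived G (carrier G) = {\<one>\<^bsub>?Z\<^esub>}"
    using h.derived_img[OF subset_refl] Z.derived_eq_singleton[of "h ` carrier G"] h.hom_closed
    by (simp add: image_subset_iff)
  then have "h y = 0" if "y \<in> derived G (carrier G)" for y using that by auto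
  then show ?thesis using Vg g(1) unfolding h_def by blast
qed

text \<open>For the smallest prime divisor \<open>p\<close> of the order, every prime dividing
  \<open>p - 1\<close> is smaller than \<open>p\<close> and so does not divide the order. This is
  the coprimality that the transfer argument requires.\<close>

lemma C_group_not_perfect:
  assumes C: "C_group G" and "carrier G \<noteq> {\<one>}"
  shows "derived G (carrier G) \<noteq> carrier G"
proof -
  have fin: "finite (carrier G)" using C by (simp add: C_group_def)
  have n: "order G > 0" using fin order_gt_0_iff_finite by simp
  have "order G \<noteq> 1" using assms(2) order_one_triv_iff by simp
  then have ex: "\<exists>p. prime p \<and> p dvd order G" by (rule prime_factor_nat)
  define p where "p = (LEAST p. prime p \<and> p dvd order G)"
  have p: "prime p" "p dvd order G" using LeastI_ex[OF ex] by (simp_all add: p_def)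
  have p_least: "p \<le> q" if "prime q" "q dvd order G" for q
    unfolding p_def using that by (intro Least_le) simp
  have cop: "coprime (order G) (p - 1)"
  proof (rule ccontr)
    assume "\<not> coprime (order G) (p - 1)"
    then obtain q where q: "prime q" "q dvd order G" "q dvd p - 1"
      by (meson coprime_iff_gcd_eq_1 dvd_trans gcd_dvd1 gcd_dvd2 prime_factor_nat)
    then have "q \<le> p - 1" using prime_gt_1_nat[OF p(1)] by (intro dvd_imp_le) auto
    then show False using p_least[OF q(1,2)] prime_gt_1_nat[OF p(1)] by simp
  qed
  obtain m where m: "order G = p ^ multiplicity p (order G) * m" "\<not> p dvd m"
    using sylow_subgroup_index[OF fin p(1)] .
  obtain g where g: "g \<in> carrier G" "ord g = p ^ multiplicity p (order G)"
    using C_group_sylow_generator[OF C p(1)] .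
  have "multiplicity p (order G) > 0"
    using p n by (metis m mult_1 not_gr_zero power_0)
  from not_perfect_of_cyclic_sylow[OF fin p(1) cop m this g] show ?thesis .
qed

end

section \<open>Cyclic abelianizations\<close>

lemma (in comm_group) ord_mult_coprime:
  assumes "x \<in> carrier G" "y \<in> carrier G" "coprime (ord x) (ord y)"
  shows "ord (x \<otimes> y) = ord x * ord y"
proof (rule dvd_antisym)
  show "ord (x \<otimes> y) dvd ord x * ord y" by (rule abelian_ord_mul_divides[OF assms(1,2)])
  have aux: "ord u dvd ord (u \<otimes> v)"
    if uv: "u \<in> carrier G" "v \<in> carrier G" "coprime (ord u) (ord v)" for u v
  proof -
    let ?k = "ord (u \<otimes> v)"
    have "\<one> = ((u \<otimes> v) [^] ?k) [^] ord v" using uv by simp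
    also have "\<dots> = u [^] (?k * ord v) \<otimes> (v [^] ord v) [^] ?k"
      using uv by (simp add: nat_pow_pow nat_pow_distrib mult.commute del: pow_ord_eq_1)
    also have "\<dots> = u [^] (?k * ord v)" using uv by simp
    finally have "ord u dvd ?k * ord v" by (rule iffD1[OF pow_eq_id[OF uv(1)], OF sym])
    then show ?thesis using uv(3) coprime_dvd_mult_left_iff by blast
  qed
  show "ord x * ord y dvd ord (x \<otimes> y)"
    using aux[of x y] aux[of y x] assms by (intro divides_mult) (auto simp: coprime_commute m_comm)
qed

lemma (in comm_group) ex_ord_eq_order:
  assumes fin: "finite (carrier G)"
    and ex: "\<And>p. prime p \<Longrightarrow> \<exists>x \<in> carrier G. ord x = p ^ multiplicity p (order G)"
  shows "\<exists>x \<in> carrier G. ord x = order G"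
proof -
  have "\<exists>x \<in> carrier G. ord x = (\<Prod>p\<in>S. p ^ multiplicity p (order G))"
    if "finite S" "\<And>p. p \<in> S \<Longrightarrow> prime p" for S
    using that
  proof (induction S rule: finite_induct)
    case empty
    then show ?case by (intro bexI[of _ \<one>]) auto
  next
    case (insert p S)
    obtain x where x: "x \<in> carrier G" "ord x = (\<Prod>p\<in>S. p ^ multiplicity p (order G))"
      using insert by auto
    obtain y where y: "y \<in> carrier G" "ord y = p ^ multiplicity p (order G)"
      using ex insert.prems by blast
    have "coprime (p ^ multiplicity p (order G)) (\<Prod>q\<in>S. q ^ multiplicity q (order G))"
    proof (rule prod_coprime_right)
      fix q assume "q \<in> S"
      then have "coprime p q" using insert by (intro primes_coprime) auto
      then show "coprime (p ^ multiplicity p (order G)) (q ^ multiplicity q (order G))" by simp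
    qed
    then have "ord (y \<otimes> x) = ord y * ord x"
      using x y by (intro ord_mult_coprime) simp_all
    then show ?case using x y insert.hyps by (intro bexI[of _ "y \<otimes> x"]) auto
  qed
  from this[of "prime_factors (order G)"] show ?thesis
    using fin order_gt_0_iff_finite prime_factorization_nat[of "order G"] by auto
qed

context group
begin

text \<open>The image of a generator of a Sylow subgroup has order the full \<open>p\<close>-part of
  the quotient; multiplying such elements over all primes gives a generator of the abelian
  quotient.\<close>

lemma C_group_abelianization_cyclic:
  assumes C: "C_group G"
  obtains y where "y \<in> carrier G"
    "\<And>x. x \<in> carrier G \<Longrightarrow> \<exists>d \<in> derived G (carrier G). \<exists>i :: int. x = d \<otimes> y [^] i"
proof -
  define D where "D = derived G (carrier G)"
  have fin: "finite (carrier G)" using C by (simp add: C_group_def)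
  have n: "order G > 0" using fin order_gt_0_iff_finite by simp
  interpret D: normal D G unfolding D_def by (rule derived_self_is_normal)
  have Ds: "subgroup D G" by (rule D.subgroup_axioms)
  let ?A = "G Mod D"
  interpret A: comm_group ?A unfolding D_def by (rule derived_quot_is_comm_group)
  have A_carrier: "carrier ?A = (\<lambda>x. D #> x) ` carrier G" by (rule carrier_FactGroup)
  have finA: "finite (carrier ?A)" using fin A_carrier by simp
  have n_eq: "order G = order ?A * card D"
    using lagrange[OF Ds] by (simp add: order_def FactGroup_def)
  have "\<exists>X \<in> carrier ?A. A.ord X = p ^ multiplicity p (order ?A)" if p: "prime p" for p
  proof -
    define a where "a = multiplicity p (order G)"
    obtain g where g: "g \<in> carrier G" "ord g = p ^ a"
      using C_group_sylow_generator[OF C p] unfolding a_def .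
    define X where "X = D #> g"
    have X: "X \<in> carrier ?A" using g(1) A_carrier by (simp add: X_def)
    have X_pow: "X [^]\<^bsub>?A\<^esub> k = D #> (g [^] k)" for k :: nat
      unfolding X_def by (rule D.FactGroup_pow[OF g(1)])
    have "X [^]\<^bsub>?A\<^esub> (p ^ a) = \<one>\<^bsub>?A\<^esub>"
      unfolding X_pow g(2)[symmetric] using g(1) D.subset by simp
    then have "A.ord X dvd p ^ a" using A.pow_eq_id[OF X] by blast
    then obtain i where i: "i \<le> a" "A.ord X = p ^ i"
      using divides_primepow_nat[OF p] by blast
    have "D #> (g [^] (p ^ i)) = D"
      using X_pow[of "p ^ i"] A.pow_ord_eq_1[OF X] i(2) by simp
    then have gD: "g [^] (p ^ i) \<in> D" using coset_join1 g(1) Ds by blast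
    interpret DG: group "G\<lparr>carrier := D\<rparr>" by (rule subgroup_imp_group[OF Ds])
    \<comment> \<open>The exponent \<open>i\<close> is squeezed: \<open>g [^] (p ^ i)\<close> lies
      in \<open>D\<close> with order \<open>p ^ (a - i)\<close>, which bounds \<open>i\<close> from
      below by the multiplicity in the quotient, while \<open>p ^ i\<close> divides the quotient
      order.\<close>
    have "(g [^] (p ^ i)) [^] card D = \<one>"
      using DG.pow_order_eq_1[of "g [^] (p ^ i)"] gD nat_pow_consistent by (simp add: order_def)
    then have "ord (g [^] (p ^ i)) dvd card D" using pow_eq_id g(1) by simp
    moreover have "ord (g [^] (p ^ i)) = p ^ (a - i)"
      using ord_pow[OF g(1), of "p ^ i"] g(2) i(1) p
      by (simp add: le_imp_power_dvd power_diff prime_gt_0_nat)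
    moreover have "card D \<noteq> 0" "order ?A \<noteq> 0" using n n_eq by auto
    ultimately have "a - i \<le> multiplicity p (card D)"
      using p by (intro multiplicity_geI) (auto simp: not_prime_unit)
    moreover have "a = multiplicity p (order ?A) + multiplicity p (card D)"
      unfolding a_def n_eq using p \<open>card D \<noteq> 0\<close> \<open>order ?A \<noteq> 0\<close>
      by (intro prime_elem_multiplicity_mult_distrib) auto
    moreover have "i \<le> multiplicity p (order ?A)"
      using A.ord_dvd_group_order[OF X] i(2) p \<open>order ?A \<noteq> 0\<close>
      by (intro multiplicity_geI) (auto simp: not_prime_unit)
    ultimately have "i = multiplicity p (order ?A)" using i(1) by simp
    then show ?thesis using X i(2) by blast
  qed
  then obtain Y where Y: "Y \<in> carrier ?A" "A.ord Y = order ?A"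
    using A.ex_ord_eq_order[OF finA] by blast
  then obtain y where y: "y \<in> carrier G" "Y = D #> y" using A_carrier by auto
  have "generate ?A {Y} = carrier ?A"
    using A.generate_pow_card[OF Y(1)] Y finA A.generate_incl[of "{Y}"]
    by (intro card_subset_eq) (auto simp: order_def)
  then have range: "carrier ?A = {Y [^]\<^bsub>?A\<^esub> i | i :: int. i \<in> UNIV}"
    using A.generate_pow[OF Y(1)] by simp
  show thesis
  proof (rule that[OF y(1)])
    fix x assume x: "x \<in> carrier G"
    then obtain i :: int where "D #> x = Y [^]\<^bsub>?A\<^esub> i"
      using range A_carrier by blast
    also have "\<dots> = D #> (y [^] i)"
      unfolding y(2) by (rule D.FactGroup_int_pow[OF y(1)])
    finally have "x \<in> D #> (y [^] i)" using rcos_self[OF x Ds] by simp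
    then show "\<exists>d \<in> derived G (carrier G). \<exists>i :: int. x = d \<otimes> y [^] i"
      by (auto simp: r_coset_def D_def)
  qed
qed

lemma C_group_subgroup_mod_derived:
  assumes C: "C_group G" and H: "subgroup H G"
  obtains y where "y \<in> H" "\<And>x. x \<in> H \<Longrightarrow> \<exists>d \<in> derived G H. \<exists>i :: int. x = d \<otimes> y [^] i"
proof -
  interpret H: group "G\<lparr>carrier := H\<rparr>" by (rule subgroup_imp_group[OF H])
  have eq: "derived (G\<lparr>carrier := H\<rparr>) (carrier (G\<lparr>carrier := H\<rparr>)) = derived G H"
    using derived_consistent[OF subset_refl H] by simp
  show thesis
  proof (rule H.C_group_abelianization_cyclic[OF C_group_subgroup[OF C H]], unfold eq)
    fix y assume y: "y \<in> carrier (G\<lparr>carrier := H\<rparr>)"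
      and *: "\<And>x. x \<in> carrier (G\<lparr>carrier := H\<rparr>) \<Longrightarrow>
        \<exists>d \<in> derived G H. \<exists>i :: int. x = d \<otimes>\<^bsub>G\<lparr>carrier := H\<rparr>\<^esub> y [^]\<^bsub>G\<lparr>carrier := H\<rparr>\<^esub> i"
    have yH: "y \<in> H" using y by simp
    show thesis
    proof (rule that[OF yH])
      fix x assume "x \<in> H"
      then show "\<exists>d \<in> derived G H. \<exists>i :: int. x = d \<otimes> y [^] i"
        using *[of x] by (simp flip: int_pow_consistent[OF H yH])
    qed
  qed
qed

section \<open>The derived series of a \<open>C\<close>-group\<close>

text \<open>The hypothesis \<open>conj\<close> says that the powers of \<open>v\<close> form a
  normal subgroup. Automorphisms of a cyclic group commute, so commutators act on it
  trivially.\<close>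

lemma derived_centralizes_cyclic_normal:
  assumes v: "v \<in> carrier G" and conj: "\<And>x. x \<in> carrier G \<Longrightarrow> \<exists>r :: int. x \<otimes> v \<otimes> inv x = v [^] r"
    and c: "c \<in> derived G (carrier G)"
  shows "c \<otimes> v = v \<otimes> c"
proof -
  define Z where "Z = {c \<in> carrier G. c \<otimes> v \<otimes> inv c = v}"
  have conj_mult: "(x \<otimes> y) \<otimes> w \<otimes> inv (x \<otimes> y) = x \<otimes> (y \<otimes> w \<otimes> inv y) \<otimes> inv x"
    if "x \<in> carrier G" "y \<in> carrier G" "w \<in> carrier G" for x y w
    using that by (simp add: m_assoc inv_mult_group)
  have Z: "subgroup Z G"
  proof
    fix x y assume "x \<in> Z" "y \<in> Z"
    then show "x \<otimes> y \<in> Z" using v conj_mult[of x y v] by (simp add: Z_def)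
  next
    fix x assume x: "x \<in> Z"
    then have "inv x \<otimes> (x \<otimes> v \<otimes> inv x) \<otimes> inv (inv x) = v"
      using v conj_mult[of "inv x" x v] by (simp add: Z_def)
    then show "inv x \<in> Z" using x by (simp add: Z_def)
  qed (use v in \<open>auto simp: Z_def\<close>)
  have "derived_set G (carrier G) \<subseteq> Z"
  proof
    fix c assume "c \<in> derived_set G (carrier G)"
    then obtain x y where xy: "x \<in> carrier G" "y \<in> carrier G" "c = x \<otimes> y \<otimes> inv x \<otimes> inv y"
      by auto
    obtain r s r' s' :: int where rs: "x \<otimes> v \<otimes> inv x = v [^] r" "y \<otimes> v \<otimes> inv y = v [^] s"
        "inv x \<otimes> v \<otimes> inv (inv x) = v [^] r'" "inv y \<otimes> v \<otimes> inv (inv y) = v [^] s'"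
      using conj xy inv_closed by meson
    have act: "u \<otimes> v [^] k \<otimes> inv u = v [^] (t * k)"
      if "u \<in> carrier G" "u \<otimes> v \<otimes> inv u = v [^] t" for u and t k :: int
      using conj_int_pow[OF that(1) v, of k] that(2) v by (simp add: int_pow_pow)
    \<comment> \<open>Exponents matter only modulo the order of \<open>v\<close>, so mutually
      inverse actions are expressed by equal powers of \<open>v\<close> and not by
      \<open>r * r' = 1\<close>.\<close>
    have "v [^] (r * r') = v" "v [^] (s * s') = v"
      using act[OF xy(1) rs(1), of r'] conj_mult[of x "inv x" v] act[OF xy(2) rs(2), of s']
        conj_mult[of y "inv y" v] rs(3,4) xy v by simp_all
    have "c \<otimes> v \<otimes> inv c = x \<otimes> (y \<otimes> (inv x \<otimes> (inv y \<otimes> v \<otimes> inv (inv y)) \<otimes> inv (inv x)) \<otimes> inv y) \<otimes> inv x"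
      unfolding xy(3) using xy v by (simp only: conj_mult m_closed inv_closed)
    also have "\<dots> = v [^] (r * (s * (r' * s')))"
      unfolding rs(4) by (simp only: act[OF inv_closed[OF xy(1)] rs(3)] act[OF xy(2) rs(2)] act[OF xy(1) rs(1)])
    also have "\<dots> = (v [^] (r * r')) [^] (s * s')" using v by (simp add: int_pow_pow mult_ac)
    also have "\<dots> = v" using \<open>v [^] (r * r') = v\<close> \<open>v [^] (s * s') = v\<close> by simp
    finally show "c \<in> Z" using xy by (simp add: Z_def)
  qed
  then have "derived G (carrier G) \<subseteq> Z"
    unfolding derived_def by (rule generate_subgroup_incl[OF _ Z])
  then show ?thesis using c v by (auto simp: Z_def inv_solve_right')
qed

lemma commute_int_pow_products:
  assumes "a \<in> carrier G" "b \<in> carrier G" "a \<otimes> b = b \<otimes> a"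
  shows "(a [^] (i :: int) \<otimes> b [^] (j :: int)) \<otimes> (a [^] (k :: int) \<otimes> b [^] (l :: int))
    = (a [^] k \<otimes> b [^] l) \<otimes> (a [^] i \<otimes> b [^] j)"
proof -
  have conj_b: "b [^] j \<otimes> a \<otimes> inv (b [^] j) = a" for j :: int
  proof -
    have "a \<otimes> b \<otimes> inv a = b" using assms by (simp add: m_assoc)
    then have "a \<otimes> b [^] j \<otimes> inv a = b [^] j" using conj_int_pow[OF assms(1,2), of j] by simp
    then have "a \<otimes> b [^] j = b [^] j \<otimes> a" using assms(1,2) by (simp add: inv_solve_right')
    then show ?thesis using assms(1,2) by (metis int_pow_closed inv_solve_right' m_closed)
  qed
  have comm: "b [^] j \<otimes> a [^] k = a [^] k \<otimes> b [^] j" for j k :: int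
    using conj_int_pow[of "b [^] j" a k] conj_b[of j] assms(1,2) by (simp add: inv_solve_right')
  have "(a [^] i \<otimes> b [^] j) \<otimes> (a [^] k \<otimes> b [^] l) = a [^] (i + k) \<otimes> b [^] (j + l)" for i j k l :: int
  proof -
    have "(a [^] i \<otimes> b [^] j) \<otimes> (a [^] k \<otimes> b [^] l) = a [^] i \<otimes> (b [^] j \<otimes> a [^] k) \<otimes> b [^] l"
      using assms(1,2) by (simp add: m_assoc)
    then show ?thesis unfolding comm using assms(1,2) by (simp add: m_assoc int_pow_mult)
  qed
  then show ?thesis by (simp add: add.commute)
qed

lemma derived_trivial_if_commute:
  assumes "H \<subseteq> carrier G" "\<And>x y. x \<in> H \<Longrightarrow> y \<in> H \<Longrightarrow> x \<otimes> y = y \<otimes> x"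
  shows "derived G H \<subseteq> {\<one>}"
  unfolding derived_def
proof (rule generate_subgroup_incl[OF _ triv_subgroup])
  have "x \<otimes> y \<otimes> inv x \<otimes> inv y = \<one>" if "x \<in> H" "y \<in> H" for x y
  proof -
    have xy: "x \<in> carrier G" "y \<in> carrier G" using assms(1) that by auto
    have "x \<otimes> y \<otimes> inv x \<otimes> inv y = y \<otimes> x \<otimes> inv x \<otimes> inv y" using assms(2)[OF that] by simp
    also have "\<dots> = \<one>" using xy by (simp add: m_assoc)
    finally show ?thesis .
  qed
  then show "derived_set G H \<subseteq> {\<one>}" by auto
qed

text \<open>Modulo \<open>D''\<close> the subgroup \<open>D'\<close> is cyclic and normal, hence
  centralized by \<open>D\<close>. Since \<open>D\<close> is generated over \<open>D'\<close> by one
  element \<open>w\<close>, its image is abelian and \<open>D'\<close> equals \<open>D''\<close>. As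
  a perfect \<open>C\<close>-group, \<open>D'\<close> is trivial.\<close>

lemma C_group_metabelian:
  assumes C: "C_group G"
  shows "derived G (derived G (carrier G)) = {\<one>}"
proof -
  define D where "D = derived G (carrier G)"
  define D' where "D' = derived G D"
  define D'' where "D'' = derived G D'"
  have D: "D \<lhd> G" unfolding D_def by (rule derived_self_is_normal)
  then have D': "D' \<lhd> G" unfolding D'_def by (rule derived_is_normal)
  then have D'': "D'' \<lhd> G" unfolding D''_def by (rule derived_is_normal)
  have subs: "subgroup D G" "subgroup D' G" "subgroup D'' G"
    using D D' D'' normal_imp_subgroup by blast+
  interpret D'': normal D'' G by fact
  let ?Q = "G Mod D''"
  define \<pi> where "\<pi> x = D'' #> x" for x
  note [simp del] = one_FactGroup mult_FactGroup
  interpret Q: group ?Q by (rule D''.factorgroup_is_group)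
  interpret \<pi>: group_hom G ?Q \<pi>
    using D''.r_coset_hom_Mod Q.is_group is_group
    by (simp add: group_hom_def group_hom_axioms_def \<pi>_def[abs_def])
  have Q_carrier: "carrier ?Q = \<pi> ` carrier G" by (simp add: carrier_FactGroup \<pi>_def[abs_def])
  have \<pi>_one: "\<pi> x = \<one>\<^bsub>?Q\<^esub> \<longleftrightarrow> x \<in> D''" if "x \<in> carrier G" for x
    using coset_join1[of D'' x] coset_join2[of x D''] that subs(3) by (auto simp: \<pi>_def one_FactGroup)
  obtain w where w: "w \<in> D" "\<And>x. x \<in> D \<Longrightarrow> \<exists>d \<in> D'. \<exists>i :: int. x = d \<otimes> w [^] i"
    using C_group_subgroup_mod_derived[OF C subs(1)] unfolding D'_def by blast
  obtain v where v: "v \<in> D'" "\<And>x. x \<in> D' \<Longrightarrow> \<exists>d \<in> D''. \<exists>i :: int. x = d \<otimes> v [^] i"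
    using C_group_subgroup_mod_derived[OF C subs(2)] unfolding D''_def by blast
  have wc: "w \<in> carrier G" and vc: "v \<in> carrier G"
    using subgroup.mem_carrier[OF subs(1) w(1)] subgroup.mem_carrier[OF subs(2) v(1)] .
  have \<pi>_D': "\<exists>i :: int. \<pi> x = \<pi> v [^]\<^bsub>?Q\<^esub> i" if x: "x \<in> D'" for x
  proof -
    obtain d i where di: "d \<in> D''" "x = d \<otimes> v [^] (i :: int)" using v(2)[OF x] by blast
    have dc: "d \<in> carrier G" by (rule D''.mem_carrier[OF di(1)])
    then have "\<pi> d = \<one>\<^bsub>?Q\<^esub>" using \<pi>_one di(1) by simp
    then have "\<pi> x = \<pi> v [^]\<^bsub>?Q\<^esub> i" using di(2) dc vc by (simp add: \<pi>.hom_int_pow)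
    then show ?thesis by blast
  qed
  have "c \<otimes>\<^bsub>?Q\<^esub> \<pi> v = \<pi> v \<otimes>\<^bsub>?Q\<^esub> c" if "c \<in> derived ?Q (carrier ?Q)" for c
  proof (rule Q.derived_centralizes_cyclic_normal[OF _ _ that])
    fix X assume "X \<in> carrier ?Q"
    then obtain x where x: "x \<in> carrier G" "X = \<pi> x" using Q_carrier by blast
    have "x \<otimes> v \<otimes> inv x \<in> D'" using normal.inv_op_closed2[OF D' x(1) v(1)] .
    then obtain i :: int where "\<pi> (x \<otimes> v \<otimes> inv x) = \<pi> v [^]\<^bsub>?Q\<^esub> i" using \<pi>_D' by blast
    then show "\<exists>r :: int. X \<otimes>\<^bsub>?Q\<^esub> \<pi> v \<otimes>\<^bsub>?Q\<^esub> inv\<^bsub>?Q\<^esub> X = \<pi> v [^]\<^bsub>?Q\<^esub> r"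
      using x vc by auto
  qed (use vc in simp)
  moreover have "\<pi> w \<in> derived ?Q (carrier ?Q)"
    unfolding Q_carrier \<pi>.derived_img[OF subset_refl] using w(1) by (simp add: D_def)
  ultimately have comm: "\<pi> v \<otimes>\<^bsub>?Q\<^esub> \<pi> w = \<pi> w \<otimes>\<^bsub>?Q\<^esub> \<pi> v" by simp
  have \<pi>_D: "\<exists>(i :: int) (j :: int). X = \<pi> v [^]\<^bsub>?Q\<^esub> i \<otimes>\<^bsub>?Q\<^esub> \<pi> w [^]\<^bsub>?Q\<^esub> j" if X: "X \<in> \<pi> ` D" for X
  proof -
    obtain x where x: "x \<in> D" "X = \<pi> x" using X by blast
    obtain d j where dj: "d \<in> D'" "x = d \<otimes> w [^] (j :: int)" using w(2)[OF x(1)] by blast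
    obtain i :: int where i: "\<pi> d = \<pi> v [^]\<^bsub>?Q\<^esub> i" using \<pi>_D'[OF dj(1)] by blast
    have "d \<in> carrier G" by (rule subgroup.mem_carrier[OF subs(2) dj(1)])
    then have "\<pi> x = \<pi> v [^]\<^bsub>?Q\<^esub> i \<otimes>\<^bsub>?Q\<^esub> \<pi> w [^]\<^bsub>?Q\<^esub> j"
      using dj(2) i wc by (simp add: \<pi>.hom_int_pow)
    then show ?thesis using x(2) by blast
  qed
  have "derived ?Q (\<pi> ` D) \<subseteq> {\<one>\<^bsub>?Q\<^esub>}"
  proof (rule Q.derived_trivial_if_commute)
    show "\<pi> ` D \<subseteq> carrier ?Q" using Q_carrier subgroup.subset[OF subs(1)] by blast
    fix X Y assume "X \<in> \<pi> ` D" "Y \<in> \<pi> ` D"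
    then obtain i j k l :: int
      where "X = \<pi> v [^]\<^bsub>?Q\<^esub> i \<otimes>\<^bsub>?Q\<^esub> \<pi> w [^]\<^bsub>?Q\<^esub> j" "Y = \<pi> v [^]\<^bsub>?Q\<^esub> k \<otimes>\<^bsub>?Q\<^esub> \<pi> w [^]\<^bsub>?Q\<^esub> l"
      using \<pi>_D by meson
    then show "X \<otimes>\<^bsub>?Q\<^esub> Y = Y \<otimes>\<^bsub>?Q\<^esub> X"
      using Q.commute_int_pow_products[OF _ _ comm] vc wc by simp
  qed
  then have "\<pi> ` D' \<subseteq> {\<one>\<^bsub>?Q\<^esub>}"
    unfolding D'_def \<pi>.derived_img[OF subgroup.subset[OF subs(1)]] .
  then have "D' \<subseteq> D''" using \<pi>_one subgroup.mem_carrier[OF subs(2)] by blast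
  moreover have "D'' \<subseteq> D'" unfolding D''_def by (rule derived_incl[OF subset_refl subs(2)])
  ultimately have "derived G D' = D'" unfolding D''_def by blast
  then have "derived (G\<lparr>carrier := D'\<rparr>) D' = D'" using derived_consistent[OF subset_refl subs(2)] by simp
  then have "D' = {\<one>}"
    using group.C_group_not_perfect[OF subgroup_imp_group[OF subs(2)] C_group_subgroup[OF C subs(2)]]
    by auto
  then show ?thesis by (simp add: D'_def D_def)
qed

section \<open>Two cyclic factors of coprime orders\<close>

text \<open>A finite cyclic group has one subgroup of order \<open>p\<close>. With
  \<open>ord g = p * m\<close>, both exponents are multiples of \<open>m\<close>, and the cofactor
  of the first is invertible modulo \<open>p\<close>.\<close>

lemma cyclic_order_p_powers:
  assumes g: "g \<in> carrier G" and p: "prime p"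
    and ord: "ord (g [^] (i :: int)) = p" "ord (g [^] (j :: int)) = p" "ord g > 0"
  shows "\<exists>c :: int. g [^] j = (g [^] i) [^] c"
proof -
  have p0: "p > 0" using p by (simp add: prime_gt_0_nat)
  have dvd: "int (ord g) dvd k * int p" if "ord (g [^] k) = p" for k :: int
  proof -
    have "(g [^] k) [^] int p = \<one>"
      using that g by (metis int_pow_closed int_pow_int pow_ord_eq_1)
    then show ?thesis using g by (simp add: int_pow_pow int_pow_eq_id)
  qed
  have "p dvd ord g"
  proof -
    have "(g [^] i) [^] ord g = (g [^] int (ord g)) [^] i"
      using g by (simp add: int_pow_pow mult.commute flip: int_pow_int)
    also have "\<dots> = \<one>" using g by (simp add: int_pow_int)
    finally show ?thesis using pow_eq_id[of "g [^] i" "ord g"] g ord(1) by simp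
  qed
  then obtain m where m: "ord g = p * m" by blast
  then have "int m dvd i" "int m dvd j"
    using dvd[OF ord(1)] dvd[OF ord(2)] p0 by (simp_all add: mult.commute[of _ "int p"])
  then obtain i' j' where ij: "i = int m * i'" "j = int m * j'" by (auto elim!: dvdE)
  have "\<not> int p dvd i'"
  proof
    assume "int p dvd i'"
    then have "int (ord g) dvd i" unfolding m ij by (auto intro: mult_dvd_mono simp: mult.commute)
    then have "g [^] i = \<one>" using int_pow_eq_id[OF g] by simp
    then show False using ord(1) prime_gt_1_nat[OF p] by simp
  qed
  then have "coprime i' (int p)"
    using p by (metis coprime_commute prime_imp_coprime prime_nat_int_transfer)
  then obtain c where "[i' * c = 1] (mod int p)" using cong_solve_coprime_int by blast
  then have "int p dvd i' * c - 1" by (simp add: cong_iff_dvd_diff)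
  then have "int p dvd (i' * c - 1) * j'" by simp
  then have "int m * int p dvd int m * ((i' * c - 1) * j')" by simp
  then have "int (ord g) dvd i * (c * j') - j"
    unfolding m ij by (simp add: algebra_simps)
  then have "g [^] j = g [^] (i * (c * j'))" using int_pow_eq[OF g] by blast
  also have "\<dots> = (g [^] i) [^] (c * j')" using g by (simp add: int_pow_pow)
  finally show ?thesis by blast
qed

lemma C_group_coprime_factorization:
  assumes C: "C_group G"
  obtains x y where "x \<in> carrier G" "y \<in> carrier G" "coprime (ord x) (ord y)"
    "\<And>z. z \<in> carrier G \<Longrightarrow> \<exists>(i :: int) (j :: int). z = x [^] i \<otimes> y [^] j"
proof -
  have fin: "finite (carrier G)" using C by (simp add: C_group_def)
  define D where "D = derived G (carrier G)"
  interpret D: normal D G unfolding D_def by (rule derived_self_is_normal)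
  have Ds: "subgroup D G" by (rule D.subgroup_axioms)
  obtain x where x: "x \<in> D" "\<And>z. z \<in> D \<Longrightarrow> \<exists>d \<in> derived G D. \<exists>i :: int. z = d \<otimes> x [^] i"
    using C_group_subgroup_mod_derived[OF C Ds] by blast
  have xc: "x \<in> carrier G" using x(1) by simp
  have Dx: "\<exists>i :: int. z = x [^] i" if "z \<in> D" for z
    using x(2)[OF that] C_group_metabelian[OF C] xc by (auto simp flip: D_def)
  have xD: "x [^] i \<in> D" for i :: int using subgroup_int_pow_closed[OF Ds x(1)] .
  obtain y where y: "y \<in> carrier G" "\<And>z. z \<in> carrier G \<Longrightarrow> \<exists>d \<in> D. \<exists>i :: int. z = d \<otimes> y [^] i"
    using C_group_abelianization_cyclic[OF C] unfolding D_def by blast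
  have span: "\<exists>(i :: int) (j :: int). z = x [^] i \<otimes> y [^] j" if "z \<in> carrier G" for z
    using y(2)[OF that] Dx by metis
  have conj: "\<exists>r :: int. z \<otimes> x \<otimes> inv z = x [^] r" if "z \<in> carrier G" for z
    using Dx[OF D.inv_op_closed2[OF that x(1)]] .
  obtain r :: int where r: "y \<otimes> x \<otimes> inv y = x [^] r" using conj[OF y(1)] by blast
  \<comment> \<open>The commutator of \<open>y\<close> and \<open>x\<close>. Modulo the powers of
    \<open>e\<close> the two generators commute, so the quotient is abelian and \<open>D\<close> is
    contained in \<open>E\<close>.\<close>
  define e where "e = x [^] (r - 1)"
  have ec: "e \<in> carrier G" using xc by (simp add: e_def)
  define E where "E = range (\<lambda>i :: int. e [^] i)"
  have Es: "subgroup E G" unfolding E_def by (rule subgroup_of_powers[OF ec])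
  have "E \<lhd> G"
    unfolding normal_inv_iff
  proof (intro conjI ballI Es)
    fix z h assume z: "z \<in> carrier G" and "h \<in> E"
    then obtain k :: int where k: "h = x [^] ((r - 1) * k)"
      using xc by (auto simp: E_def e_def int_pow_pow)
    obtain t :: int where t: "z \<otimes> x \<otimes> inv z = x [^] t" using conj[OF z] by blast
    have "z \<otimes> h \<otimes> inv z = e [^] (t * k)"
      unfolding k conj_int_pow[OF z xc] t e_def using xc by (simp add: int_pow_pow mult_ac)
    then show "z \<otimes> h \<otimes> inv z \<in> E" by (simp add: E_def)
  qed
  then interpret E: normal E G .
  let ?Q = "G Mod E"
  define \<pi> where "\<pi> z = E #> z" for z
  note [simp del] = one_FactGroup mult_FactGroup
  interpret Q: group ?Q by (rule E.factorgroup_is_group)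
  interpret \<pi>: group_hom G ?Q \<pi>
    using E.r_coset_hom_Mod Q.is_group is_group
    by (simp add: group_hom_def group_hom_axioms_def \<pi>_def[abs_def])
  have Q_carrier: "carrier ?Q = \<pi> ` carrier G" by (simp add: carrier_FactGroup \<pi>_def[abs_def])
  have comm: "\<pi> x \<otimes>\<^bsub>?Q\<^esub> \<pi> y = \<pi> y \<otimes>\<^bsub>?Q\<^esub> \<pi> x"
  proof -
    have "e \<in> E" unfolding E_def using ec by (metis int_pow_1 rangeI)
    then have "\<pi> e = \<one>\<^bsub>?Q\<^esub>" using coset_join2[OF ec Es] by (simp add: \<pi>_def one_FactGroup)
    moreover have "y \<otimes> x = e \<otimes> x \<otimes> y"
    proof -
      have "e \<otimes> x = y \<otimes> x \<otimes> inv y"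
        unfolding r e_def using xc by (metis diff_add_cancel int_pow_1 int_pow_mult)
      then show ?thesis using xc y(1) ec by (simp add: m_assoc)
    qed
    ultimately have "\<pi> y \<otimes>\<^bsub>?Q\<^esub> \<pi> x = \<pi> x \<otimes>\<^bsub>?Q\<^esub> \<pi> y"
      using xc y(1) ec \<pi>.hom_mult[of y x] \<pi>.hom_mult[of "e \<otimes> x" y] by simp
    then show ?thesis by simp
  qed
  have "comm_group ?Q"
  proof (rule Q.group_comm_groupI)
    have \<pi>_span: "\<exists>(i :: int) (j :: int). X = \<pi> x [^]\<^bsub>?Q\<^esub> i \<otimes>\<^bsub>?Q\<^esub> \<pi> y [^]\<^bsub>?Q\<^esub> j" if X: "X \<in> carrier ?Q" for X
    proof -
      obtain z where z: "z \<in> carrier G" "X = \<pi> z" using X Q_carrier by blast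
      obtain i j :: int where "z = x [^] i \<otimes> y [^] j" using span[OF z(1)] by blast
      then have "X = \<pi> x [^]\<^bsub>?Q\<^esub> i \<otimes>\<^bsub>?Q\<^esub> \<pi> y [^]\<^bsub>?Q\<^esub> j"
        using z(2) xc y(1) by (simp add: \<pi>.hom_int_pow)
      then show ?thesis by blast
    qed
    fix X Y assume "X \<in> carrier ?Q" "Y \<in> carrier ?Q"
    then obtain i j k l :: int
      where "X = \<pi> x [^]\<^bsub>?Q\<^esub> i \<otimes>\<^bsub>?Q\<^esub> \<pi> y [^]\<^bsub>?Q\<^esub> j" "Y = \<pi> x [^]\<^bsub>?Q\<^esub> k \<otimes>\<^bsub>?Q\<^esub> \<pi> y [^]\<^bsub>?Q\<^esub> l"
      using \<pi>_span by meson
    then show "X \<otimes>\<^bsub>?Q\<^esub> Y = Y \<otimes>\<^bsub>?Q\<^esub> X"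
      using Q.commute_int_pow_products[OF _ _ comm] xc y(1) by simp
  qed
  then have "D \<subseteq> E" unfolding D_def by (rule derived_minimal[OF \<open>E \<lhd> G\<close>])
  then obtain q :: int where "x = e [^] q" using x(1) by (auto simp: E_def)
  then have "x [^] (1 :: int) = x [^] ((r - 1) * q)" using xc by (simp add: e_def int_pow_pow)
  \<comment> \<open>So \<open>r - 1\<close> is a unit modulo \<open>ord x\<close>, with inverse
    \<open>q\<close>.\<close>
  then have q: "int (ord x) dvd (r - 1) * q - 1" using int_pow_eq[OF xc] by blast
  \<comment> \<open>A power of \<open>y\<close> in \<open>D\<close> is fixed by conjugation with
    \<open>y\<close>, which acts on \<open>D\<close> by the exponent \<open>r\<close>; multiplying
    by the inverse \<open>q\<close> of \<open>r - 1\<close> kills its exponent.\<close>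
  have y_D: "y [^] j = \<one>" if yj: "y [^] j \<in> D" for j :: int
  proof -
    obtain s :: int where s: "y [^] j = x [^] s" using Dx[OF yj] by blast
    have "y \<otimes> y [^] j \<otimes> inv y = y [^] j"
      using conj_int_pow[OF y(1) y(1), of j] y(1) by (simp add: m_assoc)
    then have "x [^] s = x [^] (r * s)"
      unfolding s using conj_int_pow[OF xc xc] conj_int_pow[OF y(1) xc, of s] r xc
      by (simp add: int_pow_pow)
    then have "int (ord x) dvd r * s - s" using int_pow_eq[OF xc] by blast
    then have "int (ord x) dvd (r * s - s) * q - s * ((r - 1) * q - 1)"
      using q by (intro dvd_diff) auto
    also have "(r * s - s) * q - s * ((r - 1) * q - 1) = s" by (simp add: algebra_simps)
    finally show ?thesis unfolding s using int_pow_eq_id[OF xc] by simp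
  qed
  have "coprime (ord x) (ord y)"
  proof (rule ccontr)
    assume "\<not> coprime (ord x) (ord y)"
    then obtain p where p: "prime p" "p dvd ord x" "p dvd ord y"
      by (meson coprime_iff_gcd_eq_1 dvd_trans gcd_dvd1 gcd_dvd2 prime_factor_nat)
    have pos: "ord x > 0" "ord y > 0"
      using ord_ge_1[OF fin xc] ord_ge_1[OF fin y(1)] by simp_all
    define u where "u = x [^] (ord x div p)"
    define w where "w = y [^] (ord y div p)"
    have p0: "p > 0" using p(1) by (simp add: prime_gt_0_nat)
    have uc: "u \<in> carrier G" and wc: "w \<in> carrier G" using xc y(1) by (simp_all add: u_def w_def)
    have ord_u: "ord u = p" and ord_w: "ord w = p"
      unfolding u_def w_def using ord_pow[OF xc, of "ord x div p"] ord_pow[OF y(1), of "ord y div p"] p pos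
      by (auto elim!: dvdE)
    have card_powers: "card (range (\<lambda>i :: int. z [^] i)) = ord z" if "z \<in> carrier G" for z
      using generate_pow_card[OF that] generate_pow[OF that] by (simp add: full_SetCompr_eq)
    have "subgroup (range (\<lambda>i :: int. w [^] i)) G" "card (range (\<lambda>i :: int. w [^] i)) = p ^ 1"
      using subgroup_of_powers[OF wc] card_powers[OF wc] ord_w by simp_all
    from C_group_p_subgroup(1)[OF C p(1) this]
    obtain P where P: "sylow_subgroup p P G" "range (\<lambda>i :: int. w [^] i) \<subseteq> P" by blast
    have PG: "subgroup P G" "card P = p ^ multiplicity p (order G)" using P(1) by (simp_all add: sylow_subgroup_def)
    have wP: "w \<in> P" using P(2) wc by (metis int_pow_1 range_eqI subsetD)
    obtain m where m: "order G = p ^ multiplicity p (order G) * m" "\<not> p dvd m"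
      using sylow_subgroup_index[OF fin p(1)] .
    have "subgroup (range (\<lambda>i :: int. u [^] i)) G" "card (range (\<lambda>i :: int. u [^] i)) = p ^ 1"
      using subgroup_of_powers[OF uc] card_powers[OF uc] ord_u by simp_all
    from p_subgroup_conjugate_in_sylow[OF fin p(1) m PG this]
    obtain z where z: "z \<in> carrier G" "\<And>i :: int. z \<otimes> u [^] i \<otimes> inv z \<in> P" by blast
    \<comment> \<open>A conjugate of each power of \<open>u\<close> lies in \<open>P\<close>. The
      powers of \<open>u\<close> form a normal subgroup, because every conjugation sends
      \<open>x\<close> to a power of itself; so \<open>u\<close> itself is one of these
      conjugates.\<close>
    have uP: "u \<in> P"
    proof -
      obtain t :: int where t: "inv z \<otimes> x \<otimes> inv (inv z) = x [^] t" using conj[OF inv_closed[OF z(1)]] by blast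
      have "inv z \<otimes> u \<otimes> inv (inv z) = u [^] t"
        using conj_int_pow[OF inv_closed[OF z(1)] xc, of "int (ord x div p)"] xc
        unfolding t by (simp add: u_def int_pow_pow mult.commute flip: int_pow_int)
      then have "z \<otimes> u [^] t \<otimes> inv z = z \<otimes> (inv z \<otimes> u \<otimes> inv (inv z)) \<otimes> inv z" by simp
      also have "\<dots> = u" using z(1) uc by (simp add: m_assoc flip: m_assoc[of z "inv z"])
      finally show ?thesis using z(2)[of t] by simp
    qed
    have "cyclic_group (G\<lparr>carrier := P\<rparr>)" using C P(1) by (simp add: C_group_def)
    then obtain g where g: "g \<in> P" "P = range (\<lambda>i :: int. g [^]\<^bsub>G\<lparr>carrier := P\<rparr>\<^esub> i)"
      unfolding group.cyclic_group[OF subgroup_imp_group[OF PG(1)]] by auto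
    then have P_range: "P = range (\<lambda>i :: int. g [^] i)"
      using int_pow_consistent[OF PG(1) g(1)] by simp
    have gc: "g \<in> carrier G" using subgroup.mem_carrier[OF PG(1) g(1)] .
    obtain i j :: int where ij: "u = g [^] i" "w = g [^] j" using uP wP P_range by blast
    \<comment> \<open>Both elements have order \<open>p\<close> in the cyclic group
      \<open>P\<close>, so \<open>w\<close> is a power of \<open>u\<close> and lies in
      \<open>D\<close>. Being also a power of \<open>y\<close>, it is trivial by \<open>y_D\<close>,
      against its order.\<close>
    obtain c :: int where c: "w = u [^] c"
      using cyclic_order_p_powers[OF gc p(1), of i j] ij ord_u ord_w ord_ge_1[OF fin gc] by auto
    have "w = y [^] int (ord y div p)" by (simp add: w_def int_pow_int)
    moreover have "w \<in> D"
      unfolding c u_def using xD xc by (simp add: int_pow_pow flip: int_pow_int)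
    ultimately have "w = \<one>" using y_D by metis
    then show False using ord_w prime_gt_1_nat[OF p(1)] by simp
  qed
  then show thesis using that xc y(1) span by blast
qed

section \<open>A cyclic regular subgroup for a \<open>C\<close>-group\<close>

text \<open>Conjugation by \<open>x\<close> followed by right multiplication with
  \<open>x \<otimes> y\<close>. The latter is \<open>hol_rho\<close> at the inverse element, since
  \<open>hol_rho\<close> itself inverts its argument.\<close>

lemma two_sided_translation_in_holomorph:
  assumes x: "x \<in> carrier G" and y: "y \<in> carrier G"
  shows "(\<lambda>z\<in>carrier G. x \<otimes> z \<otimes> y) \<in> carrier (holomorph G)"
proof -
  let ?B = "BijGroup (carrier G)"
  let ?S = "hol_rho G ` carrier G \<union> auto G"
  define c where "c = (\<lambda>z\<in>carrier G. x \<otimes> z \<otimes> inv x)"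
  define h where "h = hol_rho G (inv (x \<otimes> y))"
  have cancel: "inv x \<otimes> (x \<otimes> z) = z" "x \<otimes> (inv x \<otimes> z) = z" if "z \<in> carrier G" for z
    using x that by (subst m_assoc[symmetric]; simp)+
  have "bij_betw c (carrier G) (carrier G)"
    unfolding c_def
    by (rule bij_betw_byWitness[where f' = "\<lambda>z. inv x \<otimes> z \<otimes> x"])
      (use x in \<open>auto simp: m_assoc cancel\<close>)
  moreover have "c \<in> hom G G"
    using group_hom.homh[OF conj_hom[OF x]] by (auto simp: hom_def c_def)
  ultimately have c: "c \<in> auto G" by (simp add: auto_def Bij_def) (simp add: c_def)
  have h: "h \<in> hol_rho G ` carrier G" using x y by (simp add: h_def)
  have "h \<otimes>\<^bsub>?B\<^esub> c \<in> generate ?B ?S"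
    using c h by (intro generate.eng generate.incl) auto
  moreover have "h \<in> Bij (carrier G)" using h hol_rho_in_Bij by (auto simp: BijGroup_def)
  moreover have "c \<in> Bij (carrier G)" using c by (simp add: auto_def)
  moreover have "compose (carrier G) h c = (\<lambda>z\<in>carrier G. x \<otimes> z \<otimes> y)"
  proof
    fix z
    show "compose (carrier G) h c z = (\<lambda>z\<in>carrier G. x \<otimes> z \<otimes> y) z"
    proof (cases "z \<in> carrier G")
      case True
      have "x \<otimes> z \<otimes> inv x \<otimes> (x \<otimes> y) = x \<otimes> z \<otimes> y"
        using x y True by (simp add: m_assoc cancel)
      then show ?thesis using x y True by (simp add: compose_def h_def c_def hol_rho_def)
    qed (simp add: compose_def)
  qed
  ultimately show ?thesis by (simp add: holomorph_carrier BijGroup_def)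
qed

text \<open>The cyclic group generated by \<open>\<sigma> z = x z y\<close> is regular: \<open>\<sigma>\<^sup>i\<close> maps \<open>\<one>\<close> to
  \<open>x\<^sup>i y\<^sup>i\<close>, and by the Chinese remainder theorem the exponents of \<open>x\<close> and \<open>y\<close> are independent.\<close>

lemma realizable_cyclic_of_coprime_factorization:
  assumes fin: "finite (carrier G)" and x: "x \<in> carrier G" and y: "y \<in> carrier G"
    and cop: "coprime (ord x) (ord y)"
    and span: "\<And>z. z \<in> carrier G \<Longrightarrow> \<exists>(i :: int) (j :: int). z = x [^] i \<otimes> y [^] j"
  shows "realizable (integer_mod_group (order G)) G"
proof -
  let ?K = "holomorph G"
  let ?n = "int (order G)"
  have n: "order G > 0" using fin order_gt_0_iff_finite by simp
  interpret K: group ?K by (rule group_holomorph)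
  define \<sigma> where "\<sigma> = (\<lambda>z\<in>carrier G. x \<otimes> z \<otimes> y)"
  have \<sigma>: "\<sigma> \<in> carrier ?K" unfolding \<sigma>_def by (rule two_sided_translation_in_holomorph[OF x y])
  have KB: "f \<in> Bij (carrier G)" if "f \<in> carrier ?K" for f using carrier_holomorph_subset that by blast
  have one: "\<one>\<^bsub>?K\<^esub> = (\<lambda>z\<in>carrier G. z)"
    by (simp add: holomorph_def subgroup_generated_def BijGroup_def)
  have pow: "(\<sigma> [^]\<^bsub>?K\<^esub> i) z = x [^] i \<otimes> z \<otimes> y [^] i" if z: "z \<in> carrier G" for i :: nat and z
    using z
  proof (induction i arbitrary: z)
    case 0
    then show ?case by (simp add: one)
  next
    case (Suc i)
    have "(\<sigma> [^]\<^bsub>?K\<^esub> Suc i) z = (\<sigma> [^]\<^bsub>?K\<^esub> i) (x \<otimes> z \<otimes> y)"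
      using mult_holomorph[OF KB KB Suc.prems, of "\<sigma> [^]\<^bsub>?K\<^esub> i" \<sigma>] \<sigma> Suc.prems by (simp add: \<sigma>_def)
    also have "\<dots> = x [^] i \<otimes> (x \<otimes> z \<otimes> y) \<otimes> y [^] i" using Suc x y by simp
    also have "y [^] Suc i = y \<otimes> y [^] i" using y by (simp add: group_commutes_pow)
    then have "x [^] i \<otimes> (x \<otimes> z \<otimes> y) \<otimes> y [^] i = x [^] Suc i \<otimes> z \<otimes> y [^] Suc i"
      using x y Suc.prems by (simp add: m_assoc)
    finally show ?case .
  qed
  have "\<sigma> [^]\<^bsub>?K\<^esub> order G = \<one>\<^bsub>?K\<^esub>"
  proof
    fix z
    have ext: "\<sigma> [^]\<^bsub>?K\<^esub> order G \<in> extensional (carrier G)"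
      using KB[OF K.nat_pow_closed[OF \<sigma>]] by (simp add: Bij_def)
    show "(\<sigma> [^]\<^bsub>?K\<^esub> order G) z = \<one>\<^bsub>?K\<^esub> z"
    proof (cases "z \<in> carrier G")
      case True
      then show ?thesis
        using pow[OF True, of "order G"] by (simp add: pow_order_eq_1[OF x] pow_order_eq_1[OF y] one)
    next
      case False
      then show ?thesis using extensional_arb[OF ext False] by (simp add: one)
    qed
  qed
  \<comment> \<open>Exponents may be reduced modulo the group order as soon as the order of \<sigma>
    divides it; that distinct residues give distinct powers follows later from regularity.\<close>
  then have period: "\<sigma> [^]\<^bsub>?K\<^esub> i = \<sigma> [^]\<^bsub>?K\<^esub> (i mod ?n)" for i :: int
  proof -
    have "K.ord \<sigma> dvd order G" using K.pow_eq_id[OF \<sigma>] \<open>\<sigma> [^]\<^bsub>?K\<^esub> order G = \<one>\<^bsub>?K\<^esub>\<close> by blast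
    moreover have "?n dvd i mod ?n - i" by (simp flip: mod_eq_dvd_iff)
    ultimately have "int (K.ord \<sigma>) dvd i mod ?n - i" by (meson dvd_trans of_nat_dvd_iff)
    then show ?thesis using K.int_pow_eq[OF \<sigma>] by blast
  qed
  define f where "f i = \<sigma> [^]\<^bsub>?K\<^esub> i" for i :: int
  define H where "H = range f"
  have H: "subgroup H ?K" unfolding H_def f_def[abs_def] by (rule K.subgroup_of_powers[OF \<sigma>])
  have H_image: "H = f ` {0..<?n}"
  proof
    show "H \<subseteq> f ` {0..<?n}"
    proof
      fix h assume "h \<in> H"
      then obtain i where "h = f (i mod ?n)" using period by (auto simp: H_def f_def)
      then show "h \<in> f ` {0..<?n}" using n by auto
    qed
  qed (auto simp: H_def)
  have f_one: "f i \<one> = x [^] i \<otimes> y [^] i" if i: "i \<in> {0..<?n}" for i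
  proof -
    obtain k where k: "i = int k" using i nonneg_int_cases by auto
    show ?thesis unfolding f_def k int_pow_int pow[OF one_closed] using x by simp
  qed
  have surj: "(\<lambda>i. f i \<one>) ` {0..<?n} = carrier G"
  proof
    show "carrier G \<subseteq> (\<lambda>i. f i \<one>) ` {0..<?n}"
    proof
      fix z assume zc: "z \<in> carrier G"
      obtain i j :: int where z: "z = x [^] i \<otimes> y [^] j" using span[OF zc] by blast
      \<comment> \<open>One exponent that serves for both factors, by the Chinese remainder theorem.
        Reducing it modulo the group order is harmless because \<open>ord x\<close> and
        \<open>ord y\<close> divide that order.\<close>
      obtain l where l: "[l = i] (mod int (ord x))" "[l = j] (mod int (ord y))"
        using binary_chinese_remainder_int[of "int (ord x)" "int (ord y)" i j] cop by auto
      have reduce: "u [^] (l mod ?n) = u [^] k" if u: "u \<in> carrier G" and k: "[l = k] (mod int (ord u))" for u k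
      proof -
        have "int (ord u) dvd ?n" using ord_dvd_group_order[OF u] by simp
        then have "[l mod ?n = l] (mod int (ord u))" by (simp add: cong_def mod_mod_cancel)
        then have "[k = l mod ?n] (mod int (ord u))" using k by (meson cong_sym cong_trans)
        then show ?thesis using int_pow_eq[OF u] by (simp add: cong_iff_dvd_diff)
      qed
      have "z = f (l mod ?n) \<one>"
        unfolding z using f_one[of "l mod ?n"] n reduce[OF x l(1)] reduce[OF y l(2)] by simp
      then show "z \<in> (\<lambda>i. f i \<one>) ` {0..<?n}" using n by auto
    qed
  qed (use f_one x y in auto)
  \<comment> \<open>A surjection from \<open>order G\<close> exponents onto \<open>order G\<close>
    elements is injective. This yields both regularity of \<open>H\<close> and injectivity of
    \<open>f\<close>.\<close>
  have inj: "inj_on (\<lambda>i. f i \<one>) {0..<?n}"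
    using surj by (intro eq_card_imp_inj_on) (simp_all add: order_def)
  then have "inj_on (\<lambda>h. h \<one>) H" unfolding H_image by (auto simp: inj_on_def)
  moreover have "(\<lambda>h. h \<one>) ` H = carrier G" unfolding H_image image_image by (rule surj)
  ultimately have "regular_on H G" by (simp add: regular_on_def bij_betw_def)
  moreover have "f \<in> iso (integer_mod_group (order G)) (?K\<lparr>carrier := H\<rparr>)"
  proof (rule isoI)
    show "f \<in> hom (integer_mod_group (order G)) (?K\<lparr>carrier := H\<rparr>)"
    proof (rule homI)
      fix i j
      show "f (i \<otimes>\<^bsub>integer_mod_group (order G)\<^esub> j) = f i \<otimes>\<^bsub>?K\<lparr>carrier := H\<rparr>\<^esub> f j"
        using K.int_pow_mult[OF \<sigma>, of i j] period[of "i + j"] by (simp add: f_def)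
    qed (simp add: H_def)
    have "inj_on f {0..<?n}" using inj by (auto simp: inj_on_def)
    then show "bij_betw f (carrier (integer_mod_group (order G))) (carrier (?K\<lparr>carrier := H\<rparr>))"
      using n by (simp add: bij_betw_def carrier_integer_mod_group H_image)
  qed
  ultimately show ?thesis unfolding realizable_def using H is_isoI by blast
qed

end

theorem corollary1p6:
  fixes N :: "('a, 'b) monoid_scheme" and n :: nat
  assumes "group N" and "finite (carrier N)" and "order N = n" and "\<not> 4 dvd n"
  shows "realizable (integer_mod_group n) N \<longleftrightarrow> C_group N"
proof
  interpret group N by fact
  show "C_group N" if "realizable (integer_mod_group n) N"
    using C_group_of_realizable_cyclic assms that by blast
  assume "C_group N"
  then obtain x y where "x \<in> carrier N" "y \<in> carrier N" "coprime (ord x) (ord y)"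
    "\<And>z. z \<in> carrier N \<Longrightarrow> \<exists>(i :: int) (j :: int). z = x [^]\<^bsub>N\<^esub> i \<otimes>\<^bsub>N\<^esub> y [^]\<^bsub>N\<^esub> j"
    using C_group_coprime_factorization by blast
  then show "realizable (integer_mod_group n) N"
    using realizable_cyclic_of_coprime_factorization assms by blast
qed

end
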